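(* Let $\Xi\subseteq\mathbb{R}^d$ be closed and convex, let $c:\Xi\times\Xi\to\mathbb{R}_+$ be a transportation cost function, let $\ell:\Xi\to\mathbb{R}$ be upper semicontinuous, and let $\widehat{\mathbb P}_1,\dots,\widehat{\mathbb P}_K\in\mathcal P(\Xi)$. Assume: (1) $c$ is lower semicontinuous, $c(\xi_1,\xi_2)=0$ if and only if $\xi_1=\xi_2$, and $c(\xi_1,\xi_2)\ge \rho(\xi_1,\xi_2)^p$ for all $\xi_1,\xi_2\in\Xi$, for some metric $\rho$ on $\Xi$ with compact sublevel sets and some exponent $p\ge 1$. (2) For every $k\in[K]$, $\widehat{\mathbb P}_k=\sum_{j=1}^{N_k}p_{k,j}\,\delta_{\widehat\xi_{k,j}}$ is discrete with atoms $\widehat\xi_{k,j}\in\Xi$ and strictly positive probabilities $p_{k,j}$, $j\in[N_k]$. (3) There exist $\xi'\in\Xi$, $g'>0$ and $p'\ge 1$ with $p'\le p$ such that $\ell(\xi)\le g'(1+\rho(\xi,\xi')^{p'})$ for all $\xi\in\Xi$, where $\rho$ is the same metric as in (1). For $\varepsilon=(\varepsilon_1,\dots,\varepsilon_K)\in\mathbb{R}_+^K$ consider the primal uncertainty quantification problem $$\sup_{\mathbb Q\in\bigcap_{k=1}^K\mathbb B_{\varepsilon_k}(\widehat{\mathbb P}_k)}\int_\Xi \ell(\xi)\,\mathrm d\mathbb Q(\xi).\qquad (\mathrm P)$$ Then (P) admits the dual problem $$(\mathrm D)\qquad\begin{array}{cll}\inf & \displaystyle\sum_{k=1}^K\varepsilon_k\lambda_k+\sum_{k=1}^K\sum_{j=1}^{N_k}p_{k,j}\gamma_{k,j}\\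 \text{s.t.} & \lambda_k\in\mathbb{R}_+,\ \gamma_k\in\mathbb{R}^{N_k} & \forall k\in[K]\\ & \displaystyle\sup_{\xi\in\Xi}\ \ell(\xi)-\sum_{k=1}^K\lambda_k c(\xi,\widehat\xi_{k,\alpha_k})\le\sum_{k=1}^K\gamma_{k,\alpha_k} & \forall\alpha\in\mathcal A,\end{array}$$ and strong (i.e., gap-free) duality holds, that is, the optimal values of (P) and (D) coincide, for all $\varepsilon\in\mathbb{R}_+^K$ with $\varepsilon\notin\partial\mathcal E$.
   Context: $\mathcal P(\Xi)$ is the set of Borel probability distributions on $\Xi$ and $[n]=\{1,\dots,n\}$. For $\mathbb P_1,\mathbb P_2\in\mathcal P(\Xi)$, $\Pi(\mathbb P_1,\mathbb P_2)$ is the set of couplings (joint distributions on $\Xi^2$ with marginals $\mathbb P_1,\mathbb P_2$), and the optimal transport (OT) cost is $C(\mathbb P_1,\mathbb P_2)=\min_{\pi\in\Pi(\mathbb P_1,\mathbb P_2)}\int_{\Xi^2}c(\xi_1,\xi_2)\,\mathrm d\pi(\xi_1,\xi_2)$. For $\varepsilon_k\ge0$, $\mathbb B_{\varepsilon_k}(\widehat{\mathbb P}_k)=\{\mathbb Q\in\mathcal P(\Xi): C(\mathbb Q,\widehat{\mathbb P}_k)\le\varepsilon_k\}$. The set of multi-indices is $\mathcal A=\times_{k=1}^K[N_k]$. The set $\mathcal E$ consists of all $\varepsilon\in\mathbb{R}_+^K$ for which $\bigcap_{k=1}^K\mathbb B_{\varepsilon_k}(\widehat{\mathbb P}_k)$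 is nonempty, and $\partial\mathcal E$ is its boundary. The supremum over an empty set is $-\infty$. *)

theory Defs
  imports "HOL-Probability.Probability"
begin

definition lsc_on :: "'a::topological_space set \<Rightarrow> ('a \<Rightarrow> real) \<Rightarrow> bool" where
  "lsc_on S f \<longleftrightarrow> (\<forall>x\<in>S. \<forall>y<f x. \<forall>\<^sub>F z in at x within S. y < f z)"

definition usc_on :: "'a::topological_space set \<Rightarrow> ('a \<Rightarrow> real) \<Rightarrow> bool" where
  "usc_on S f \<longleftrightarrow> (\<forall>x\<in>S. \<forall>y>f x. \<forall>\<^sub>F z in at x within S. f z < y)"

definition borel_prob :: "'a::topological_space set \<Rightarrow> 'a measure set" where
  "borel_prob \<Xi> = {M. prob_space M \<and> sets M = sets (restrict_space borel \<Xi>)}"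

definition couplings ::
  "'a::topological_space set \<Rightarrow> 'a measure \<Rightarrow> 'a measure \<Rightarrow> ('a \<times> 'a) measure set" where
  "couplings \<Xi> P Q = {\<pi> \<in> borel_prob (\<Xi> \<times> \<Xi>).
     distr \<pi> (restrict_space borel \<Xi>) fst = P \<and> distr \<pi> (restrict_space borel \<Xi>) snd = Q}"

text \<open>
  For nonnegative lower semicontinuous \<open>c\<close> the infimum is attained whenever \<open>P\<close> and \<open>Q\<close> are
  Borel probability distributions on a closed subset of a Euclidean space.
\<close>
definition ot_cost ::
  "'a::topological_space set \<Rightarrow> ('a \<Rightarrow> 'a \<Rightarrow> real) \<Rightarrow> 'a measure \<Rightarrow> 'a measure \<Rightarrow> ennreal" where
  "ot_cost \<Xi> c P Q = (INF \<pi>\<in>couplings \<Xi> P Q. \<integral>\<^sup>+ z. ennreal (c (fst z) (snd z)) \<partial>\<pi>)"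

definition ot_ball ::
  "'a::topological_space set \<Rightarrow> ('a \<Rightarrow> 'a \<Rightarrow> real) \<Rightarrow> real \<Rightarrow> 'a measure \<Rightarrow> 'a measure set" where
  "ot_ball \<Xi> c r P = {Q \<in> borel_prob \<Xi>. ot_cost \<Xi> c Q P \<le> ennreal r}"

definition ambiguity_set ::
  "'a::topological_space set \<Rightarrow> ('a \<Rightarrow> 'a \<Rightarrow> real) \<Rightarrow> ('k::finite \<Rightarrow> 'a measure) \<Rightarrow> real ^ 'k
    \<Rightarrow> 'a measure set" where
  "ambiguity_set \<Xi> c P \<epsilon> = (\<Inter>k. ot_ball \<Xi> c (\<epsilon> $ k) (P k))"

definition feasible_radii ::
  "'a::topological_space set \<Rightarrow> ('a \<Rightarrow> 'a \<Rightarrow> real) \<Rightarrow> ('k::finite \<Rightarrow> 'a measure)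
    \<Rightarrow> (real ^ 'k) set" where
  "feasible_radii \<Xi> c P = {\<epsilon>. (\<forall>k. 0 \<le> \<epsilon> $ k) \<and> ambiguity_set \<Xi> c P \<epsilon> \<noteq> {}}"

text \<open>
  The Bochner integral is zero for non-integrable functions, whereas a loss whose negative part has
  infinite integral must have integral \<open>-\<infinity>\<close>. If both parts have infinite integral, the value is
  \<open>\<infinity> - \<infinity> = \<infinity>\<close>; the growth condition on the loss excludes this on the ambiguity set.
\<close>
definition ext_integral :: "'a measure \<Rightarrow> ('a \<Rightarrow> real) \<Rightarrow> ereal" where
  "ext_integral M f =
     enn2ereal (\<integral>\<^sup>+ x. ennreal (f x) \<partial>M) - enn2ereal (\<integral>\<^sup>+ x. ennreal (- f x) \<partial>M)"

definition primal_value ::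
  "'a::topological_space set \<Rightarrow> ('a \<Rightarrow> 'a \<Rightarrow> real) \<Rightarrow> ('k::finite \<Rightarrow> 'a measure) \<Rightarrow> ('a \<Rightarrow> real)
    \<Rightarrow> real ^ 'k \<Rightarrow> ereal" where
  "primal_value \<Xi> c P l \<epsilon> = (SUP Q\<in>ambiguity_set \<Xi> c P \<epsilon>. ext_integral Q l)"

definition multi_indices :: "('k::finite \<Rightarrow> nat) \<Rightarrow> ('k \<Rightarrow> nat) set" where
  "multi_indices N = (\<Pi>\<^sub>E k\<in>UNIV. {1..N k})"

text \<open>Only the entries \<open>\<gamma> k j\<close> with \<open>j \<in> {1..N k}\<close> are relevant below.\<close>
definition dual_feasible ::
  "'a set \<Rightarrow> ('a \<Rightarrow> 'a \<Rightarrow> real) \<Rightarrow> ('k::finite \<Rightarrow> nat) \<Rightarrow> ('k \<Rightarrow> nat \<Rightarrow> 'a) \<Rightarrow> ('a \<Rightarrow> real)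
    \<Rightarrow> ((real ^ 'k) \<times> ('k \<Rightarrow> nat \<Rightarrow> real)) set" where
  "dual_feasible \<Xi> c N x l = {(lam, \<gamma>). (\<forall>k. 0 \<le> lam $ k) \<and>
     (\<forall>\<alpha>\<in>multi_indices N.
        (SUP \<xi>\<in>\<Xi>. ereal (l \<xi> - (\<Sum>k\<in>UNIV. lam $ k * c \<xi> (x k (\<alpha> k)))))
          \<le> ereal (\<Sum>k\<in>UNIV. \<gamma> k (\<alpha> k)))}"

definition dual_value ::
  "'a set \<Rightarrow> ('a \<Rightarrow> 'a \<Rightarrow> real) \<Rightarrow> ('k::finite \<Rightarrow> nat) \<Rightarrow> ('k \<Rightarrow> nat \<Rightarrow> real)
    \<Rightarrow> ('k \<Rightarrow> nat \<Rightarrow> 'a) \<Rightarrow> ('a \<Rightarrow> real) \<Rightarrow> real ^ 'k \<Rightarrow> ereal" where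
  "dual_value \<Xi> c N p x l \<epsilon> = (INF (lam, \<gamma>)\<in>dual_feasible \<Xi> c N x l.
     ereal ((\<Sum>k\<in>UNIV. \<epsilon> $ k * lam $ k) + (\<Sum>k\<in>UNIV. \<Sum>j\<in>{1..N k}. p k j * \<gamma> k j)))"

end

theory Submission
  imports Defs
begin

text \<open>
  Weak duality needs no gluing of couplings: dual feasibility bounds the loss by a sum over \<open>k\<close> of
  functions \<open>\<xi> \<mapsto> min\<^sub>j (\<lambda>\<^sub>k c(\<xi>, \<xi>\<^sub>k\<^sub>j) + \<gamma>\<^sub>k\<^sub>j)\<close>, each of which is integrated against its own coupling.

  For the converse, finitely supported measures on \<open>\<Xi> \<times> \<A>\<close> suffice. Their moments (transport costs,
  atom masses, expected loss) form a convex cone in a finite-dimensional space. A target vector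
  outside its closure is separated from it, and the separating functional is a dual solution. A
  target vector in the closure is attained up to an arbitrarily small relaxation of radii and value,
  since the error in the atom masses can be repaired at small cost. With zero loss this shows that
  radii outside the closure of \<open>\<E>\<close> give an unbounded dual, and that radii in its interior admit a
  finitely supported Slater point, which then absorbs the relaxation.
\<close>

(* Otherwise the simplifier rewrites {1..n} to {Suc 0..n}. *)
declare One_nat_def [simp del]

text \<open>The moment cone need not be closed: mass can escape to infinity at bounded cost, so a
  target in the closure is met only approximately. Errors in costs and loss merely loosen
  inequalities, but atom masses must be exact for the second marginals to be the given
  distributions. The repair is cheap because all weights are strictly positive, which turns a small
  absolute error into a small relative one, and because \<open>\<xi>'\<close> has finite cost to the
  finitely many atoms.

  A separating functional carries a multiplier \<open>\<tau>\<close> \<ge> 0 on the loss. For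
  \<open>\<tau>\<close> > 0, division by \<open>\<tau>\<close> gives a dual solution; for
  \<open>\<tau>\<close> = 0 the loss disappears and only a direction along which the dual objective
  decreases remains. The Slater point thus has two roles: it excludes \<open>\<tau>\<close> = 0, and
  it absorbs the relaxation of the radii. Boundary radii admit no such point. A decreasing direction
  makes the dual unbounded only if the dual has some feasible point; the growth condition on the
  loss supplies one.\<close>

subsection \<open>Separation from a convex cone\<close>

text \<open>Divide by t and let t tend to 0. This extracts the first-order optimality condition of a
  projection; t is confined to (0, 1] because shrinking \<open>y\<close> to (1 - t) \<open>y\<close>
  must stay in the cone.\<close>

lemma quadratic_linear_coeff_nonneg:
  fixes a b :: real
  assumes "\<And>t. 0 < t \<Longrightarrow> t \<le> 1 \<Longrightarrow> 0 \<le> 2 * t * a + t\<^sup>2 * b"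
  shows "0 \<le> a"
proof (rule ccontr)
  assume a: "\<not> 0 \<le> a"
  \<comment> \<open>Small enough that t |b| \<le> - a, so the quadratic term cannot outweigh 2 t
    a.\<close>
  define t where "t = min 1 (- a / (1 + \<bar>b\<bar>))"
  have t: "0 < t" "t \<le> 1" using a by (auto simp: t_def divide_simps)
  have "t * \<bar>b\<bar> \<le> t * (1 + \<bar>b\<bar>)" using t by simp
  also have "\<dots> \<le> - a / (1 + \<bar>b\<bar>) * (1 + \<bar>b\<bar>)"
    by (intro mult_right_mono) (auto simp: t_def)
  also have "\<dots> = - a" by (simp add: add_nonneg_eq_0_iff)
  finally have "t * b \<le> - a" using t by (smt (verit) mult_left_mono)
  moreover have "2 * t * a + t\<^sup>2 * b = t * (2 * a + t * b)"
    by (simp add: algebra_simps power2_eq_square)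
  ultimately have "2 * t * a + t\<^sup>2 * b < 0"
    using a t by (simp add: mult_pos_neg)
  with assms[OF t] show False by simp
qed

text \<open>
  The separating functional is the residual of the projection of the given point onto the closure
  of the cone. Index sets rather than index types are used because the dimension varies below.
\<close>
lemma convex_cone_separation:
  fixes S :: "('i \<Rightarrow> real) set" and b :: "'i \<Rightarrow> real"
  assumes fin: "finite I" and zero: "(\<lambda>_. 0) \<in> S"
    and add: "\<And>s t. s \<in> S \<Longrightarrow> t \<in> S \<Longrightarrow> (\<lambda>i. s i + t i) \<in> S"
    and scale: "\<And>s r. s \<in> S \<Longrightarrow> 0 \<le> r \<Longrightarrow> (\<lambda>i. r * s i) \<in> S"
    and eta: "0 < \<eta>" and far: "\<And>s. s \<in> S \<Longrightarrow> \<exists>i\<in>I. \<eta> \<le> \<bar>s i - b i\<bar>"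
  obtains z where "\<And>s. s \<in> S \<Longrightarrow> 0 \<le> (\<Sum>i\<in>I. z i * s i)" "(\<Sum>i\<in>I. z i * b i) < 0"
proof -
  define D where "D s = (\<Sum>i\<in>I. (s i - b i)\<^sup>2)" for s
  define m where "m = (INF s\<in>S. D s)"
  have D_ge: "\<eta>\<^sup>2 \<le> D s" if "s \<in> S" for s
  proof -
    obtain i where i: "i \<in> I" "\<eta> \<le> \<bar>s i - b i\<bar>" using far[OF \<open>s \<in> S\<close>] by auto
    have "\<eta>\<^sup>2 \<le> (s i - b i)\<^sup>2" using i eta by (simp add: abs_le_square_iff[symmetric])
    also have "\<dots> \<le> D s" unfolding D_def
      using member_le_sum[OF i(1), of "\<lambda>i. (s i - b i)\<^sup>2"] fin by simp
    finally show ?thesis .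
  qed
  have bdd: "bdd_below (D ` S)" using D_ge by (auto intro!: bdd_belowI)
  have m_le: "m \<le> D s" if "s \<in> S" for s
    unfolding m_def using that bdd by (rule cINF_lower[rotated])
  have "\<eta>\<^sup>2 \<le> m" unfolding m_def using zero by (intro cINF_greatest D_ge) auto
  then have m_pos: "0 < m" using eta by (smt (verit) zero_less_power)
  have "\<exists>s. s \<in> S \<and> D s < m + inverse (real (Suc n))" for n
  proof -
    have "m < m + inverse (real (Suc n))" by simp
    then show ?thesis
      using cINF_less_iff[OF _ bdd] zero unfolding m_def by blast
  qed
  then obtain s where sS: "\<And>n. s n \<in> S" and sD: "\<And>n. D (s n) < m + inverse (real (Suc n))"
    by metis
  \<comment> \<open>Parallelogram identity: the midpoint lies in \<open>S\<close> and has squared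
    distance at least \<open>m\<close>, so near-minimizers are close to each other and a minimizing
    sequence is Cauchy in each coordinate.\<close>
  have par: "(\<Sum>i\<in>I. (u i - v i)\<^sup>2) \<le> 2 * (D u - m) + 2 * (D v - m)" if "u \<in> S" "v \<in> S" for u v
  proof -
    have "(\<lambda>i. 1/2 * (u i + v i)) \<in> S" using scale[OF add[OF that], of "1/2"] by simp
    then have "m \<le> D (\<lambda>i. 1/2 * (u i + v i))" by (rule m_le)
    moreover have "(\<Sum>i\<in>I. (u i - v i)\<^sup>2)
        = 2 * D u + 2 * D v - 4 * D (\<lambda>i. 1/2 * (u i + v i))"
      unfolding D_def sum_distrib_left sum.distrib[symmetric] sum_subtractf[symmetric]
      by (intro sum.cong refl) (simp add: power2_eq_square field_simps)
    ultimately show ?thesis by simp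
  qed
  have "\<exists>y. (\<lambda>n. s n i) \<longlonglongrightarrow> y" if i: "i \<in> I" for i
  proof -
    have "Cauchy (\<lambda>n. s n i)"
    proof (rule CauchyI)
      fix e :: real assume e: "0 < e"
      obtain M where M: "inverse (real (Suc M)) < e\<^sup>2 / 4"
        using reals_Archimedean[of "e\<^sup>2 / 4"] e by auto
      have "norm (s j i - s k i) < e" if "M \<le> j" "M \<le> k" for j k
      proof -
        have *: "inverse (real (Suc n)) \<le> inverse (real (Suc M))" if "M \<le> n" for n
          using that by (simp add: field_simps)
        have "(s j i - s k i)\<^sup>2 \<le> (\<Sum>i\<in>I. (s j i - s k i)\<^sup>2)"
          using member_le_sum[OF i, of "\<lambda>i. (s j i - s k i)\<^sup>2"] fin by simp
        also have "\<dots> \<le> 2 * (D (s j) - m) + 2 * (D (s k) - m)" by (rule par[OF sS sS])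
        also have "\<dots> < e\<^sup>2"
        proof -
          have "D (s j) < m + e\<^sup>2 / 4" using sD[of j] *[OF that(1)] M by linarith
          moreover have "D (s k) < m + e\<^sup>2 / 4" using sD[of k] *[OF that(2)] M by linarith
          ultimately show ?thesis by (simp add: field_simps)
        qed
        finally show ?thesis
          using e by (intro power2_less_imp_less[of "norm (s j i - s k i)"]) auto
      qed
      then show "\<exists>M. \<forall>m\<ge>M. \<forall>n\<ge>M. norm (s m i - s n i) < e" by blast
    qed
    then show ?thesis by (simp add: Cauchy_convergent_iff convergent_def)
  qed
  then obtain y where y: "\<And>i. i \<in> I \<Longrightarrow> (\<lambda>n. s n i) \<longlonglongrightarrow> y i" by metis
  define z where "z i = y i - b i" for i
  \<comment> \<open>The limit \<open>y\<close> need not lie in \<open>S\<close>, so its minimality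
    is obtained by passing to the limit along \<open>s n\<close>.\<close>
  have lim: "m \<le> D (\<lambda>i. r * y i + t * u i)" if "u \<in> S" "0 \<le> r" "0 \<le> t" for r t u
  proof (rule LIMSEQ_le_const)
    show "(\<lambda>n. D (\<lambda>i. r * s n i + t * u i)) \<longlonglongrightarrow> D (\<lambda>i. r * y i + t * u i)"
      unfolding D_def by (intro tendsto_intros y)
    show "\<exists>N. \<forall>n\<ge>N. m \<le> D (\<lambda>i. r * s n i + t * u i)"
      by (intro exI allI impI m_le add scale sS that)
  qed
  have "D y \<le> m"
  proof (rule LIMSEQ_le)
    show "(\<lambda>n. D (s n)) \<longlonglongrightarrow> D y" unfolding D_def by (intro tendsto_intros y)
    have "(\<lambda>n. m + inverse (real (Suc n))) \<longlonglongrightarrow> m + 0"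
      by (intro tendsto_intros LIMSEQ_inverse_real_of_nat)
    then show "(\<lambda>n. m + inverse (real (Suc n))) \<longlonglongrightarrow> m" by simp
    show "\<exists>N. \<forall>n\<ge>N. D (s n) \<le> m + inverse (real (Suc n))" using sD less_imp_le by blast
  qed
  moreover have "m \<le> D y" using lim[OF zero, of 1 0] by simp
  ultimately have Dy: "D y = m" by simp
  have expand: "D (\<lambda>i. y i + t * u i) = m + (2 * t * (\<Sum>i\<in>I. z i * u i) + t\<^sup>2 * (\<Sum>i\<in>I. (u i)\<^sup>2))"
    for t u
    unfolding Dy[symmetric] D_def sum_distrib_left sum.distrib[symmetric]
    by (intro sum.cong refl) (simp add: z_def power2_eq_square algebra_simps)
  have pos: "0 \<le> (\<Sum>i\<in>I. z i * u i)" if "u \<in> S" for u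
  proof (rule quadratic_linear_coeff_nonneg)
    fix t :: real assume "0 < t" "t \<le> 1"
    then show "0 \<le> 2 * t * (\<Sum>i\<in>I. z i * u i) + t\<^sup>2 * (\<Sum>i\<in>I. (u i)\<^sup>2)"
      using lim[OF that, of 1 t] expand[of t u] by simp
  qed
  \<comment> \<open>The direction - \<open>y\<close> is admissible as well, since (1 - t)
    \<open>y\<close> stays in the closed cone. This gives z.y \<le> 0, hence z.b = z.y - |z|^2 <
    0.\<close>
  have "0 \<le> (\<Sum>i\<in>I. z i * - y i)"
  proof (rule quadratic_linear_coeff_nonneg)
    fix t :: real assume "0 < t" "t \<le> 1"
    moreover have "(\<lambda>i. y i + t * - y i) = (\<lambda>i. (1 - t) * y i + 0 * 0)"
      by (auto simp: algebra_simps)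
    ultimately show "0 \<le> 2 * t * (\<Sum>i\<in>I. z i * - y i) + t\<^sup>2 * (\<Sum>i\<in>I. (- y i)\<^sup>2)"
      using lim[OF zero, of "1 - t" 0] expand[of t "\<lambda>i. - y i"] by simp
  qed
  moreover have "(\<Sum>i\<in>I. z i * b i) = - (\<Sum>i\<in>I. z i * - y i) - D y"
    unfolding D_def sum_negf[symmetric] sum_subtractf[symmetric]
    by (intro sum.cong refl) (simp add: z_def power2_eq_square algebra_simps)
  ultimately have "(\<Sum>i\<in>I. z i * b i) < 0" using m_pos Dy by linarith
  with pos show ?thesis by (rule that)
qed

subsection \<open>Moments of finitely supported measures\<close>

text \<open>A triple (r, \<xi>, \<alpha>) is mass r at the point (\<xi>, \<alpha>). Lists with
  possible repetitions make addition of measures mere concatenation, with no normal form to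
  maintain.\<close>

definition moment :: "(real \<times> 'a \<times> 'b) list \<Rightarrow> ('a \<Rightarrow> 'b \<Rightarrow> real) \<Rightarrow> real" where
  "moment w f = (\<Sum>(r, \<xi>, \<alpha>)\<leftarrow>w. r * f \<xi> \<alpha>)"

definition scale_list :: "real \<Rightarrow> (real \<times> 'a \<times> 'b) list \<Rightarrow> (real \<times> 'a \<times> 'b) list" where
  "scale_list t w = map (\<lambda>(r, \<xi>, \<alpha>). (t * r, \<xi>, \<alpha>)) w"

lemma moment_Nil [simp]: "moment [] f = 0"
  and moment_Cons [simp]: "moment ((r, \<xi>, \<alpha>) # w) f = r * f \<xi> \<alpha> + moment w f"
  and moment_append [simp]: "moment (w @ w') f = moment w f + moment w' f"
  by (simp_all add: moment_def)

lemma moment_scale_list [simp]: "moment (scale_list t w) f = t * moment w f"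
  by (induction w) (auto simp: scale_list_def moment_def algebra_simps)

lemma moment_add: "moment w (\<lambda>\<xi> \<alpha>. f \<xi> \<alpha> + g \<xi> \<alpha>) = moment w f + moment w g"
  by (induction w) (auto simp: algebra_simps)

lemma moment_cmult: "moment w (\<lambda>\<xi> \<alpha>. a * f \<xi> \<alpha>) = a * moment w f"
  by (induction w) (auto simp: algebra_simps)

lemma moment_sum: "moment w (\<lambda>\<xi> \<alpha>. \<Sum>i\<in>I. f i \<xi> \<alpha>) = (\<Sum>i\<in>I. moment w (f i))"
  by (induction w) (auto simp: sum_distrib_left sum.distrib)

section \<open>Multi-indices and couplings of their marginals\<close>

lemma finite_multi_indices [simp]: "finite (multi_indices N)"
  unfolding multi_indices_def by (intro finite_PiE) auto

lemma multi_indicesD: "\<alpha> \<in> multi_indices N \<Longrightarrow> \<alpha> k \<in> {1..N k}"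
  unfolding multi_indices_def by (auto simp: PiE_iff)

text \<open>The product measure, normalized for a common total mass \<open>R\<close> that need not
  be 1: when one index is fixed, each of the other \<open>CARD('k) - 1\<close> factors sums to
  \<open>R\<close>.\<close>

lemma product_coupling:
  fixes r :: "'k::finite \<Rightarrow> nat \<Rightarrow> real"
  assumes nonneg: "\<And>k j. j \<in> {1..N k} \<Longrightarrow> 0 \<le> r k j"
    and mass: "\<And>k. (\<Sum>j\<in>{1..N k}. r k j) = R"
  obtains \<pi> where "\<And>\<alpha>. \<alpha> \<in> multi_indices N \<Longrightarrow> 0 \<le> \<pi> \<alpha>"
    "\<And>k j. j \<in> {1..N k} \<Longrightarrow> (\<Sum>\<alpha>\<in>multi_indices N. \<pi> \<alpha> * of_bool (\<alpha> k = j)) = r k j"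
proof
  define \<pi> where "\<pi> \<alpha> = (\<Prod>k\<in>UNIV. r k (\<alpha> k)) / R ^ (CARD('k) - 1)" for \<alpha>
  have R: "0 \<le> R" using mass[of undefined] nonneg by (metis sum_nonneg)
  show "0 \<le> \<pi> \<alpha>" if "\<alpha> \<in> multi_indices N" for \<alpha>
    unfolding \<pi>_def using R nonneg multi_indicesD[OF that]
    by (intro divide_nonneg_nonneg prod_nonneg) auto
  show "(\<Sum>\<alpha>\<in>multi_indices N. \<pi> \<alpha> * of_bool (\<alpha> k = j)) = r k j" if j: "j \<in> {1..N k}" for k j
  proof (cases "R = 0")
    case True
    have "r i j = 0" if "j \<in> {1..N i}" for i j
      using sum_nonneg_eq_0_iff[of "{1..N i}" "r i"] nonneg mass[of i] that True by auto
    then have "r k j = 0" and "\<pi> \<alpha> = 0" if "\<alpha> \<in> multi_indices N" for \<alpha>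
      using j multi_indicesD[OF that] unfolding \<pi>_def by auto
    then show ?thesis using \<open>\<And>i j. j \<in> {1..N i} \<Longrightarrow> r i j = 0\<close> j by simp
  next
    case False
    \<comment> \<open>The indicator is absorbed into the \<open>k\<close>-th factor, so that the sum
      over multi-indices factorizes.\<close>
    define f where "f i n = r i n * (if i = k then of_bool (n = j) else 1)" for i n
    have "(\<Prod>i\<in>UNIV. f i (\<alpha> i)) = (\<Prod>i\<in>UNIV. r i (\<alpha> i)) * of_bool (\<alpha> k = j)" for \<alpha>
      by (simp add: f_def prod.distrib prod.delta)
    then have "(\<Sum>\<alpha>\<in>multi_indices N. \<pi> \<alpha> * of_bool (\<alpha> k = j))
        = (\<Sum>\<alpha>\<in>multi_indices N. \<Prod>i\<in>UNIV. f i (\<alpha> i)) / R ^ (CARD('k) - 1)"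
      unfolding \<pi>_def sum_divide_distrib by simp
    also have "(\<Sum>\<alpha>\<in>multi_indices N. \<Prod>i\<in>UNIV. f i (\<alpha> i))
        = (\<Prod>i\<in>UNIV. \<Sum>n\<in>{1..N i}. f i n)"
      unfolding multi_indices_def by (intro prod_sum_PiE[symmetric]) auto
    also have "\<dots> = (\<Sum>n\<in>{1..N k}. f k n) * (\<Prod>i\<in>UNIV - {k}. \<Sum>n\<in>{1..N i}. f i n)"
      by (intro prod.remove) auto
    also have "(\<Sum>n\<in>{1..N k}. f k n) = (\<Sum>n\<in>{1..N k}. if n = j then r k j else 0)"
      by (intro sum.cong) (auto simp: f_def)
    also have "\<dots> = r k j" using j by (subst sum.delta) auto
    also have "(\<Prod>i\<in>UNIV - {k}. \<Sum>n\<in>{1..N i}. f i n) = (\<Prod>i\<in>UNIV - {k}. R)"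
      by (intro prod.cong) (auto simp: f_def mass)
    also have "\<dots> = R ^ (CARD('k) - 1)" by (simp add: card_Diff_singleton)
    finally show ?thesis using False by simp
  qed
qed

section \<open>Plans: finitely supported measures with prescribed atom masses\<close>

locale discrete_transport =
  fixes \<Xi> :: "'a::euclidean_space set" and c :: "'a \<Rightarrow> 'a \<Rightarrow> real"
    and N :: "'k::finite \<Rightarrow> nat" and p :: "'k \<Rightarrow> nat \<Rightarrow> real" and x :: "'k \<Rightarrow> nat \<Rightarrow> 'a"
    and \<xi>' :: 'a
  assumes c_nonneg: "\<And>\<xi>\<^sub>1 \<xi>\<^sub>2. \<xi>\<^sub>1 \<in> \<Xi> \<Longrightarrow> \<xi>\<^sub>2 \<in> \<Xi> \<Longrightarrow> 0 \<le> c \<xi>\<^sub>1 \<xi>\<^sub>2"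
    and atoms: "\<And>k j. j \<in> {1..N k} \<Longrightarrow> x k j \<in> \<Xi>"
    and weights_pos: "\<And>k j. j \<in> {1..N k} \<Longrightarrow> 0 < p k j"
    and weights_sum: "\<And>k. (\<Sum>j\<in>{1..N k}. p k j) = 1"
    and base_point: "\<xi>' \<in> \<Xi>"
begin

definition weighted :: "(real \<times> 'a \<times> ('k \<Rightarrow> nat)) list \<Rightarrow> bool" where
  "weighted w \<longleftrightarrow> (\<forall>(r, \<xi>, \<alpha>)\<in>set w. 0 \<le> r \<and> \<xi> \<in> \<Xi> \<and> \<alpha> \<in> multi_indices N)"

definition cost :: "'k \<Rightarrow> 'a \<Rightarrow> ('k \<Rightarrow> nat) \<Rightarrow> real" where
  "cost k \<xi> \<alpha> = c \<xi> (x k (\<alpha> k))"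

definition at_atom :: "'k \<Rightarrow> nat \<Rightarrow> 'a \<Rightarrow> ('k \<Rightarrow> nat) \<Rightarrow> real" where
  "at_atom k j \<xi> \<alpha> = of_bool (\<alpha> k = j)"

text \<open>
  A finitely supported measure on \<open>\<Xi> \<times> \<A>\<close>; its \<open>\<Xi>\<close>-marginal is a distribution in the ambiguity
  set with radii \<open>u\<close> whose expected loss is at least \<open>v\<close>.
\<close>
definition plan ::
  "('a \<Rightarrow> real) \<Rightarrow> ('k \<Rightarrow> real) \<Rightarrow> real \<Rightarrow> (real \<times> 'a \<times> ('k \<Rightarrow> nat)) list \<Rightarrow> bool" where
  "plan l u v w \<longleftrightarrow> weighted w \<and> (\<forall>k. moment w (cost k) \<le> u k)
     \<and> (\<forall>k. \<forall>j\<in>{1..N k}. moment w (at_atom k j) = p k j)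
     \<and> v \<le> moment w (\<lambda>\<xi> \<alpha>. l \<xi>)"

lemma weighted_simps [simp]:
  "weighted []"
  "weighted ((r, \<xi>, \<alpha>) # w) \<longleftrightarrow> 0 \<le> r \<and> \<xi> \<in> \<Xi> \<and> \<alpha> \<in> multi_indices N \<and> weighted w"
  "weighted (w @ w') \<longleftrightarrow> weighted w \<and> weighted w'"
  by (fastforce simp: weighted_def)+

lemma weighted_scale_list: "weighted w \<Longrightarrow> 0 \<le> t \<Longrightarrow> weighted (scale_list t w)"
  by (auto simp: weighted_def scale_list_def)

lemma moment_mono:
  assumes "weighted w" "\<And>\<xi> \<alpha>. \<xi> \<in> \<Xi> \<Longrightarrow> \<alpha> \<in> multi_indices N \<Longrightarrow> f \<xi> \<alpha> \<le> g \<xi> \<alpha>"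
  shows "moment w f \<le> moment w g"
  using assms(1) by (induction w) (auto intro!: add_mono mult_left_mono assms(2))

lemma cost_nonneg: "\<xi> \<in> \<Xi> \<Longrightarrow> \<alpha> \<in> multi_indices N \<Longrightarrow> 0 \<le> cost k \<xi> \<alpha>"
  unfolding cost_def by (intro c_nonneg atoms multi_indicesD)

lemma moment_cost_nonneg: "weighted w \<Longrightarrow> 0 \<le> moment w (cost k)"
  using moment_mono[of w "\<lambda>_ _. 0" "cost k"] cost_nonneg
  by (simp add: moment_cmult[of w 0 "\<lambda>_ _. 0", simplified])

lemma sum_at_atom:
  "\<alpha> \<in> multi_indices N \<Longrightarrow> (\<Sum>j\<in>{1..N k}. f j * at_atom k j \<xi> \<alpha>) = f (\<alpha> k)"
  using multi_indicesD[of \<alpha> N k] by (simp add: at_atom_def of_bool_def if_distrib cong: if_cong)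

text \<open>A function of one index sees only the marginal of that index. With f = 1 it shows that
  all marginals have the same total mass.\<close>

lemma moment_sum_at_atom:
  assumes "weighted w"
  shows "(\<Sum>j\<in>{1..N k}. f j * moment w (at_atom k j)) = moment w (\<lambda>\<xi> \<alpha>. f (\<alpha> k))"
proof -
  have "(\<Sum>j\<in>{1..N k}. f j * moment w (at_atom k j))
      = moment w (\<lambda>\<xi> \<alpha>. \<Sum>j\<in>{1..N k}. f j * at_atom k j \<xi> \<alpha>)"
    by (simp add: moment_sum moment_cmult)
  also have "\<dots> = moment w (\<lambda>\<xi> \<alpha>. f (\<alpha> k))"
    by (intro antisym moment_mono assms) (simp_all add: sum_at_atom)
  finally show ?thesis .
qed

text \<open>
  Shrinking the approximate plan by \<open>1 - t\<close> leaves room below \<open>p\<close> in every marginal; the missing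
  mass is placed at \<open>\<xi>'\<close>.
\<close>
lemma repair_marginals:
  assumes w: "weighted w" and t: "0 \<le> t" "t \<le> 1"
    and close: "\<And>k j. j \<in> {1..N k} \<Longrightarrow> \<bar>moment w (at_atom k j) - p k j\<bar> \<le> t * p k j"
    and C: "\<And>k \<alpha>. \<alpha> \<in> multi_indices N \<Longrightarrow> cost k \<xi>' \<alpha> \<le> C"
  obtains w' where "weighted w'" "\<And>k j. j \<in> {1..N k} \<Longrightarrow> moment w' (at_atom k j) = p k j"
    "\<And>k. moment w' (cost k) \<le> moment w (cost k) + 2 * t * C"
    "(1 - t) * moment w (\<lambda>\<xi> \<alpha>. l \<xi>) - 2 * t * \<bar>l \<xi>'\<bar> \<le> moment w' (\<lambda>\<xi> \<alpha>. l \<xi>)"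
proof -
  define r where "r k j = p k j - (1 - t) * moment w (at_atom k j)" for k j
  define R where "R = 1 - (1 - t) * moment w (\<lambda>\<xi> \<alpha>. 1)"
  \<comment> \<open>The masses overshoot by at most the factor 1 + t, and (1 - t) (1 + t) \<le>
    1.\<close>
  have r_nonneg: "0 \<le> r k j" if j: "j \<in> {1..N k}" for k j
  proof -
    have "(1 - t) * moment w (at_atom k j) \<le> (1 - t) * ((1 + t) * p k j)"
      using close[OF j] t by (intro mult_left_mono) (auto simp: algebra_simps)
    also have "\<dots> = p k j - t\<^sup>2 * p k j" by (simp add: algebra_simps power2_eq_square)
    also have "\<dots> \<le> p k j" using weights_pos[OF j] by simp
    finally show ?thesis by (simp add: r_def)
  qed
  \<comment> \<open>The masses fall short by at most the factor 1 - t, and 1 - (1 - t)^2 \<le> 2 t;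
    this is the 2 in the conclusions.\<close>
  have r_le: "r k j \<le> 2 * t * p k j" if j: "j \<in> {1..N k}" for k j
  proof -
    have "(1 - t) * ((1 - t) * p k j) \<le> (1 - t) * moment w (at_atom k j)"
      using close[OF j] t by (intro mult_left_mono) (auto simp: algebra_simps)
    moreover have "(1 - t) * ((1 - t) * p k j) = p k j - 2 * t * p k j + t\<^sup>2 * p k j"
      by (simp add: algebra_simps power2_eq_square)
    moreover have "0 \<le> t\<^sup>2 * p k j" using weights_pos[OF j] by simp
    ultimately show ?thesis by (simp add: r_def)
  qed
  \<comment> \<open>The missing mass is the same for every \<open>k\<close>, as required for
    coupling the deficits.\<close>
  have r_sum: "(\<Sum>j\<in>{1..N k}. r k j) = R" for k
    using moment_sum_at_atom[OF w, of "\<lambda>_. 1" k]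
    by (simp add: r_def R_def sum_subtractf weights_sum flip: sum_distrib_left)
  \<comment> \<open>\<open>undefined\<close> is used as an arbitrary element of the nonempty index
    type.\<close>
  have R_le: "R \<le> 2 * t"
  proof -
    have "R \<le> (\<Sum>j\<in>{1..N undefined}. 2 * t * p undefined j)"
      unfolding r_sum[of undefined, symmetric] by (intro sum_mono r_le)
    then show ?thesis by (simp add: weights_sum flip: sum_distrib_left)
  qed
  have R_nonneg: "0 \<le> R" unfolding r_sum[of undefined, symmetric] by (intro sum_nonneg r_nonneg)
  obtain \<pi> where pi_nonneg: "\<And>\<alpha>. \<alpha> \<in> multi_indices N \<Longrightarrow> 0 \<le> \<pi> \<alpha>"
    and pi_marg: "\<And>k j. j \<in> {1..N k} \<Longrightarrow>
      (\<Sum>\<alpha>\<in>multi_indices N. \<pi> \<alpha> * of_bool (\<alpha> k = j)) = r k j"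
    using product_coupling[of N r R, OF r_nonneg r_sum] by blast
  obtain as where as: "set as = multi_indices N" "distinct as"
    using finite_distinct_list[OF finite_multi_indices] by blast
  define w2 where "w2 = map (\<lambda>\<alpha>. (\<pi> \<alpha>, \<xi>', \<alpha>)) as"
  have mom2: "moment w2 f = (\<Sum>\<alpha>\<in>multi_indices N. \<pi> \<alpha> * f \<xi>' \<alpha>)" for f
    by (simp add: w2_def moment_def o_def sum_list_distinct_conv_sum_set as flip: as(1))
  have w2: "weighted w2" using as base_point pi_nonneg by (auto simp: w2_def weighted_def)
  have mom2_marg: "moment w2 (at_atom k j) = r k j" if "j \<in> {1..N k}" for k j
    using pi_marg[OF that] by (simp add: mom2 at_atom_def)
  have mom2_1: "moment w2 (\<lambda>\<xi> \<alpha>. a) = a * R" for a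
    using moment_sum_at_atom[OF w2, of "\<lambda>_. a" undefined] r_sum[of undefined] mom2_marg
    by (simp flip: sum_distrib_left)
  show ?thesis
  proof
    let ?w = "scale_list (1 - t) w @ w2"
    show "weighted ?w" using w w2 t by (simp add: weighted_scale_list)
    show "moment ?w (at_atom k j) = p k j" if "j \<in> {1..N k}" for k j
      using mom2_marg[OF that] by (simp add: r_def)
    show "moment ?w (cost k) \<le> moment w (cost k) + 2 * t * C" for k
    proof -
      obtain \<alpha> where "\<alpha> \<in> multi_indices N"
        using weights_sum unfolding multi_indices_def
        by (metis PiE_eq_empty_iff all_not_in_conv sum.empty zero_neq_one)
      then have C0: "0 \<le> C" using C[of \<alpha> k] cost_nonneg[OF base_point, of \<alpha> k] by simp
      have "(1 - t) * moment w (cost k) \<le> 1 * moment w (cost k)"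
        using t moment_cost_nonneg[OF w] by (intro mult_right_mono) auto
      moreover have "moment w2 (cost k) \<le> moment w2 (\<lambda>_ _. C)"
        unfolding mom2 using pi_nonneg C by (intro sum_mono mult_left_mono)
      moreover have "C * R \<le> C * (2 * t)" using R_le C0 by (rule mult_left_mono)
      ultimately show ?thesis by (simp add: mom2_1 mult.commute)
    qed
    have "\<bar>l \<xi>'\<bar> * R \<le> \<bar>l \<xi>'\<bar> * (2 * t)" using R_le by (intro mult_left_mono) auto
    moreover have "moment w2 (\<lambda>\<xi> \<alpha>. l \<xi>) = moment w2 (\<lambda>\<xi> \<alpha>. l \<xi>')" by (simp add: mom2)
    moreover have "- (\<bar>l \<xi>'\<bar> * R) \<le> l \<xi>' * R"
      using R_nonneg by (metis abs_ge_minus_self abs_le_D2 abs_mult abs_of_nonneg minus_le_iff)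
    ultimately show "(1 - t) * moment w (\<lambda>\<xi> \<alpha>. l \<xi>) - 2 * t * \<bar>l \<xi>'\<bar>
        \<le> moment ?w (\<lambda>\<xi> \<alpha>. l \<xi>)"
      by (simp add: mom2_1 mult.commute)
  qed
qed

text \<open>Either the target (\<open>u\<close>, \<open>p\<close>, \<open>v\<close>) has positive
  distance from the cone of attainable moments and is separated from it, or it is a limit of
  attainable moments.\<close>

lemma separation_or_approximate_moments:
  fixes l :: "'a \<Rightarrow> real"
  obtains (separated) lam \<gamma> \<tau> where "\<And>k. 0 \<le> lam k" "0 \<le> \<tau>"
      "\<And>\<xi> \<alpha>. \<xi> \<in> \<Xi> \<Longrightarrow> \<alpha> \<in> multi_indices N
        \<Longrightarrow> \<tau> * l \<xi> \<le> (\<Sum>k\<in>UNIV. lam k * cost k \<xi> \<alpha> + \<gamma> k (\<alpha> k))"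
      "(\<Sum>k\<in>UNIV. u k * lam k) + (\<Sum>k\<in>UNIV. \<Sum>j\<in>{1..N k}. p k j * \<gamma> k j) < \<tau> * v"
  | (near) "\<And>\<eta>. 0 < \<eta> \<Longrightarrow> \<exists>w. weighted w \<and> (\<forall>k. moment w (cost k) \<le> u k + \<eta>)
      \<and> (\<forall>k. \<forall>j\<in>{1..N k}. \<bar>moment w (at_atom k j) - p k j\<bar> \<le> \<eta>)
      \<and> v - \<eta> \<le> moment w (\<lambda>\<xi> \<alpha>. l \<xi>)"
proof -
  define I :: "('k + 'k \<times> nat + unit) set" where
    "I = UNIV <+> (Sigma UNIV (\<lambda>k. {1..N k}) <+> {()})"
  define b where "b = case_sum u (case_sum (\<lambda>(k, j). p k j) (\<lambda>_::unit. v))"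
  \<comment> \<open>Slack is allowed upward in the costs and downward in the loss, which fixes the
    signs of \<open>lam\<close> and \<open>\<tau>\<close>. The atom masses are exact, so
    \<open>\<gamma>\<close> is free in sign.\<close>
  define S :: "('k + 'k \<times> nat + unit \<Rightarrow> real) set" where
    "S = {s. \<exists>w. weighted w \<and> (\<forall>k. moment w (cost k) \<le> s (Inl k))
      \<and> (\<forall>k. \<forall>j\<in>{1..N k}. s (Inr (Inl (k, j))) = moment w (at_atom k j))
      \<and> s (Inr (Inr ())) \<le> moment w (\<lambda>\<xi> \<alpha>. l \<xi>)}"
  have SI: "s \<in> S" if "weighted w" "\<And>k. moment w (cost k) \<le> s (Inl k)"
    "\<And>k j. j \<in> {1..N k} \<Longrightarrow> s (Inr (Inl (k, j))) = moment w (at_atom k j)"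
    "s (Inr (Inr ())) \<le> moment w (\<lambda>\<xi> \<alpha>. l \<xi>)" for s w
    using that unfolding S_def by blast
  have sum_I: "(\<Sum>i\<in>I. z i * s i) = (\<Sum>k\<in>UNIV. z (Inl k) * s (Inl k))
      + (\<Sum>k\<in>UNIV. \<Sum>j\<in>{1..N k}. z (Inr (Inl (k, j))) * s (Inr (Inl (k, j))))
      + z (Inr (Inr ())) * s (Inr (Inr ()))" for z s :: "'k + 'k \<times> nat + unit \<Rightarrow> real"
    unfolding I_def by (simp add: sum.Plus sum.Sigma)
  have fin: "finite I" unfolding I_def by auto
  have zero: "(\<lambda>_. 0) \<in> S" by (rule SI[of "[]"]) auto
  have add: "(\<lambda>i. s i + t i) \<in> S" if st: "s \<in> S" "t \<in> S" for s t
  proof -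
    obtain w where w: "weighted w" "\<And>k. moment w (cost k) \<le> s (Inl k)"
      "\<And>k j. j \<in> {1..N k} \<Longrightarrow> s (Inr (Inl (k, j))) = moment w (at_atom k j)"
      "s (Inr (Inr ())) \<le> moment w (\<lambda>\<xi> \<alpha>. l \<xi>)" using st(1) unfolding S_def by blast
    obtain w' where w': "weighted w'" "\<And>k. moment w' (cost k) \<le> t (Inl k)"
      "\<And>k j. j \<in> {1..N k} \<Longrightarrow> t (Inr (Inl (k, j))) = moment w' (at_atom k j)"
      "t (Inr (Inr ())) \<le> moment w' (\<lambda>\<xi> \<alpha>. l \<xi>)" using st(2) unfolding S_def by blast
    show ?thesis using w w' by (intro SI[of "w @ w'"]) (auto intro: add_mono)
  qed
  have scale: "(\<lambda>i. r * s i) \<in> S" if s: "s \<in> S" and r: "0 \<le> r" for s r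
  proof -
    obtain w where w: "weighted w" "\<And>k. moment w (cost k) \<le> s (Inl k)"
      "\<And>k j. j \<in> {1..N k} \<Longrightarrow> s (Inr (Inl (k, j))) = moment w (at_atom k j)"
      "s (Inr (Inr ())) \<le> moment w (\<lambda>\<xi> \<alpha>. l \<xi>)" using s unfolding S_def by blast
    show ?thesis using w r
      by (intro SI[of "scale_list r w"]) (auto intro: mult_left_mono weighted_scale_list)
  qed
  show ?thesis
  proof (cases "\<exists>\<eta>>0. \<forall>s\<in>S. \<exists>i\<in>I. \<eta> \<le> \<bar>s i - b i\<bar>")
    case True
    then obtain \<eta> where eta: "0 < \<eta>" and far: "\<And>s. s \<in> S \<Longrightarrow> \<exists>i\<in>I. \<eta> \<le> \<bar>s i - b i\<bar>" by blast
    obtain z where z: "\<And>s. s \<in> S \<Longrightarrow> 0 \<le> (\<Sum>i\<in>I. z i * s i)" and zb: "(\<Sum>i\<in>I. z i * b i) < 0"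
      using convex_cone_separation[OF fin zero add scale eta far] by blast
    define lam where "lam k = z (Inl k)" for k
    define \<gamma> where "\<gamma> k j = z (Inr (Inl (k, j)))" for k j
    define \<tau> where "\<tau> = - z (Inr (Inr ()))"
    show ?thesis
    proof (rule separated)
      show "0 \<le> lam k" for k
      proof -
        \<comment> \<open>A unit vector in a cost direction is pure slack over the zero
          measure.\<close>
        have "(\<lambda>i. of_bool (i = Inl k)) \<in> S" by (rule SI[of "[]"]) auto
        from z[OF this] show ?thesis
          unfolding sum_I lam_def by (simp add: of_bool_def if_distrib cong: if_cong)
      qed
      have "(\<lambda>i. - of_bool (i = Inr (Inr ()))) \<in> S" by (rule SI[of "[]"]) auto
      from z[OF this] show "0 \<le> \<tau>" unfolding sum_I \<tau>_def by simp
      show "\<tau> * l \<xi> \<le> (\<Sum>k\<in>UNIV. lam k * cost k \<xi> \<alpha> + \<gamma> k (\<alpha> k))"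
        if "\<xi> \<in> \<Xi>" "\<alpha> \<in> multi_indices N" for \<xi> \<alpha>
      proof -
        define s where "s = case_sum (\<lambda>k. cost k \<xi> \<alpha>)
          (case_sum (\<lambda>(k, j). at_atom k j \<xi> \<alpha>) (\<lambda>_::unit. l \<xi>))"
        \<comment> \<open>Testing the functional on a unit point mass yields the pointwise dual
          constraint.\<close>
        have "s \<in> S" using that by (intro SI[of "[(1, \<xi>, \<alpha>)]"]) (auto simp: s_def)
        from z[OF this] show ?thesis
          unfolding sum_I s_def lam_def[symmetric] \<gamma>_def[symmetric]
          by (simp add: sum_at_atom that \<tau>_def sum.distrib)
      qed
      show "(\<Sum>k\<in>UNIV. u k * lam k) + (\<Sum>k\<in>UNIV. \<Sum>j\<in>{1..N k}. p k j * \<gamma> k j) < \<tau> * v"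
        using zb unfolding sum_I b_def lam_def[symmetric] \<gamma>_def[symmetric]
        by (simp add: \<tau>_def mult.commute)
    qed
  next
    case False
    show ?thesis
    proof (rule near)
      fix \<eta> :: real assume "0 < \<eta>"
      then obtain s where s: "s \<in> S" and close: "\<And>i. i \<in> I \<Longrightarrow> \<bar>s i - b i\<bar> < \<eta>"
        using False by (auto simp: not_le)
      obtain w where w: "weighted w" "\<And>k. moment w (cost k) \<le> s (Inl k)"
        "\<And>k j. j \<in> {1..N k} \<Longrightarrow> s (Inr (Inl (k, j))) = moment w (at_atom k j)"
        "s (Inr (Inr ())) \<le> moment w (\<lambda>\<xi> \<alpha>. l \<xi>)" using s unfolding S_def by blast
      have "moment w (cost k) \<le> u k + \<eta>" for k
        using w(2)[of k] close[of "Inl k"] by (force simp: I_def b_def)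
      moreover have "\<bar>moment w (at_atom k j) - p k j\<bar> \<le> \<eta>" if "j \<in> {1..N k}" for k j
      proof -
        have "Inr (Inl (k, j)) \<in> I" using that by (auto simp: I_def)
        from close[OF this] w(3)[OF that] show ?thesis by (simp add: b_def)
      qed
      moreover have "v - \<eta> \<le> moment w (\<lambda>\<xi> \<alpha>. l \<xi>)"
        using w(4) close[of "Inr (Inr ())"] by (force simp: I_def b_def)
      ultimately show "\<exists>w. weighted w \<and> (\<forall>k. moment w (cost k) \<le> u k + \<eta>)
        \<and> (\<forall>k. \<forall>j\<in>{1..N k}. \<bar>moment w (at_atom k j) - p k j\<bar> \<le> \<eta>)
        \<and> v - \<eta> \<le> moment w (\<lambda>\<xi> \<alpha>. l \<xi>)"
        using w(1) by blast
    qed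
  qed
qed

text \<open>Choose the tolerance so fine that the marginal repair costs at most
  \<open>\<delta>\<close> in every radius and in the value.\<close>

lemma exact_plan_of_approximate:
  assumes approx: "\<And>\<eta>. 0 < \<eta> \<Longrightarrow> \<exists>w. weighted w \<and> (\<forall>k. moment w (cost k) \<le> u k + \<eta>)
      \<and> (\<forall>k. \<forall>j\<in>{1..N k}. \<bar>moment w (at_atom k j) - p k j\<bar> \<le> \<eta>)
      \<and> v - \<eta> \<le> moment w (\<lambda>\<xi> \<alpha>. l \<xi>)"
    and delta: "0 < \<delta>"
  shows "\<exists>w. plan l (\<lambda>k. u k + \<delta>) (v - \<delta>) w"
proof -
  let ?Z = "{(k, j). j \<in> {1..N k}}"
  have fin: "finite ?Z" by (rule finite_subset[of _ "SIGMA k:UNIV. {1..N k}"]) auto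
  have "multi_indices N \<noteq> {}"
    using weights_sum unfolding multi_indices_def
    by (metis PiE_eq_empty_iff sum.empty zero_neq_one)
  \<comment> \<open>With tolerance t times the least weight, the error at each atom is at most t
    times its own weight, as the repair demands.\<close>
  define pm where "pm = Min ((\<lambda>(k, j). p k j) ` ?Z)"
  have ne: "?Z \<noteq> {}" using \<open>multi_indices N \<noteq> {}\<close> multi_indicesD by blast
  have pm_pos: "0 < pm" unfolding pm_def using ne fin weights_pos by (subst Min_gr_iff) auto
  have pm_le: "pm \<le> p k j" if "j \<in> {1..N k}" for k j
    unfolding pm_def using fin that by (intro Min_le) (auto intro: rev_image_eqI[of "(k, j)"])
  have p_le: "p k j \<le> 1" if "j \<in> {1..N k}" for k j
    using member_le_sum[of j "{1..N k}" "p k"] that weights_pos[of _ k] weights_sum[of k]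
    by (auto intro: less_imp_le)
  have pm_le_1: "pm \<le> 1" using ne pm_le p_le by fastforce
  define C where "C = (\<Sum>\<alpha>\<in>multi_indices N. \<Sum>k\<in>UNIV. cost k \<xi>' \<alpha>)"
  have C: "cost k \<xi>' \<alpha> \<le> C" if "\<alpha> \<in> multi_indices N" for k \<alpha>
  proof -
    have "cost k \<xi>' \<alpha> \<le> (\<Sum>k\<in>UNIV. cost k \<xi>' \<alpha>)"
      by (rule member_le_sum) (auto simp: cost_nonneg base_point that)
    also have "\<dots> \<le> C" unfolding C_def using that
      by (intro member_le_sum) (auto intro!: sum_nonneg simp: cost_nonneg base_point)
    finally show ?thesis .
  qed
  have C0: "0 \<le> C" unfolding C_def by (auto intro!: sum_nonneg simp: cost_nonneg base_point)
  \<comment> \<open>t \<open>B\<close> dominates both losses: t (1 + 2 \<open>C\<close>) in each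
    radius and t (1 + |v| + 2 |l \<xi>'|) in the value.\<close>
  define B where "B = 2 + \<bar>v\<bar> + 2 * C + 2 * \<bar>l \<xi>'\<bar>"
  define t where "t = min 1 (\<delta> / B)"
  have B: "2 \<le> B" using C0 by (simp add: B_def)
  have t: "0 < t" "t \<le> 1" "t * B \<le> \<delta>"
    using B delta by (auto simp: t_def min_def field_simps)
  obtain w where w: "weighted w" and w_cost: "\<And>k. moment w (cost k) \<le> u k + t * pm"
    and w_marg: "\<And>k j. j \<in> {1..N k} \<Longrightarrow> \<bar>moment w (at_atom k j) - p k j\<bar> \<le> t * pm"
    and w_val: "v - t * pm \<le> moment w (\<lambda>\<xi> \<alpha>. l \<xi>)"
    using approx[of "t * pm"] t pm_pos by auto
  have tpm: "t * pm \<le> t" using t pm_le_1 by (simp add: mult_left_le)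
  have "\<bar>moment w (at_atom k j) - p k j\<bar> \<le> t * p k j" if "j \<in> {1..N k}" for k j
    using w_marg[OF that] pm_le[OF that] t by (meson less_imp_le mult_left_mono order_trans)
  from repair_marginals[OF w less_imp_le[OF t(1)] t(2) this C, where l = l]
  obtain w' where w': "weighted w'" "\<And>k j. j \<in> {1..N k} \<Longrightarrow> moment w' (at_atom k j) = p k j"
    "\<And>k. moment w' (cost k) \<le> moment w (cost k) + 2 * t * C"
    "(1 - t) * moment w (\<lambda>\<xi> \<alpha>. l \<xi>) - 2 * t * \<bar>l \<xi>'\<bar> \<le> moment w' (\<lambda>\<xi> \<alpha>. l \<xi>)"
    by blast
  have tB: "t * B = 2 * t + t * \<bar>v\<bar> + 2 * t * C + 2 * t * \<bar>l \<xi>'\<bar>"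
    by (simp add: B_def algebra_simps)
  have nn: "0 \<le> t * \<bar>v\<bar>" "0 \<le> t * C" "0 \<le> t * \<bar>l \<xi>'\<bar>" using t C0 by auto
  have "moment w' (cost k) \<le> u k + \<delta>" for k
    using w'(3)[of k] w_cost[of k] tpm t tB nn by linarith
  moreover have "v - \<delta> \<le> moment w' (\<lambda>\<xi> \<alpha>. l \<xi>)"
  proof -
    have "v - t \<le> moment w (\<lambda>\<xi> \<alpha>. l \<xi>)" using w_val tpm by linarith
    then have "(1 - t) * (v - t) \<le> (1 - t) * moment w (\<lambda>\<xi> \<alpha>. l \<xi>)"
      using t by (intro mult_left_mono) auto
    moreover have "(1 - t) * (v - t) = v - t * v - t + t * t" by (simp add: algebra_simps)
    moreover have "t * v \<le> t * \<bar>v\<bar>" "0 \<le> t * t" using t by (auto intro: mult_left_mono)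
    ultimately show ?thesis using w'(4) t tB nn by linarith
  qed
  ultimately have "plan l (\<lambda>k. u k + \<delta>) (v - \<delta>) w'" using w'(1,2) by (simp add: plan_def)
  then show ?thesis by blast
qed

text \<open>Integrate the pointwise inequality against the plan. With \<open>\<tau>\<close> = 0 it
  shows that a plan within the given radii is incompatible with a separating functional.\<close>

lemma plan_pairing:
  assumes w: "plan l u v w" and lam: "\<And>k. 0 \<le> lam k" and tau: "0 \<le> \<tau>"
    and le: "\<And>\<xi> \<alpha>. \<xi> \<in> \<Xi> \<Longrightarrow> \<alpha> \<in> multi_indices N
        \<Longrightarrow> \<tau> * l \<xi> \<le> (\<Sum>k\<in>UNIV. lam k * cost k \<xi> \<alpha> + \<gamma> k (\<alpha> k))"
  shows "\<tau> * v \<le> (\<Sum>k\<in>UNIV. u k * lam k) + (\<Sum>k\<in>UNIV. \<Sum>j\<in>{1..N k}. p k j * \<gamma> k j)"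
proof -
  have "\<tau> * v \<le> \<tau> * moment w (\<lambda>\<xi> \<alpha>. l \<xi>)"
    using w tau by (intro mult_left_mono) (auto simp: plan_def)
  also have "\<dots> \<le> moment w (\<lambda>\<xi> \<alpha>. \<Sum>k\<in>UNIV. lam k * cost k \<xi> \<alpha> + \<gamma> k (\<alpha> k))"
    unfolding moment_cmult[symmetric] using w le by (intro moment_mono) (auto simp: plan_def)
  also have "\<dots> = (\<Sum>k\<in>UNIV. lam k * moment w (cost k) + moment w (\<lambda>\<xi> \<alpha>. \<gamma> k (\<alpha> k)))"
    by (simp add: moment_sum moment_add moment_cmult)
  also have "\<dots> = (\<Sum>k\<in>UNIV. lam k * moment w (cost k)
      + (\<Sum>j\<in>{1..N k}. p k j * \<gamma> k j))"
    using w by (intro sum.cong refl arg_cong2[where f = "(+)"])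
      (auto simp: plan_def moment_sum_at_atom[symmetric] mult.commute intro!: sum.cong)
  also have "\<dots> \<le> (\<Sum>k\<in>UNIV. u k * lam k + (\<Sum>j\<in>{1..N k}. p k j * \<gamma> k j))"
    using w lam by (intro sum_mono add_right_mono)
      (auto simp: plan_def mult.commute intro!: mult_left_mono)
  finally show ?thesis by (simp add: sum.distrib)
qed

lemma plan_mix:
  assumes "plan l u v w" "plan l u' v' w'" "0 \<le> t" "t \<le> 1"
  shows "plan l (\<lambda>k. (1 - t) * u k + t * u' k) ((1 - t) * v + t * v')
    (scale_list (1 - t) w @ scale_list t w')"
  using assms unfolding plan_def
  by (auto intro!: add_mono mult_left_mono weighted_scale_list) (simp add: algebra_simps)

end

subsection \<open>Measurability and extended integrals\<close>

text \<open>Strict superlevel sets are relatively open in \<open>S\<close>. The punctured filter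
  says nothing at x itself, where the inequality is known separately.\<close>

lemma borel_measurable_lsc_on:
  fixes f :: "'a::topological_space \<Rightarrow> real"
  assumes "lsc_on S f"
  shows "f \<in> borel_measurable (restrict_space borel S)"
proof (rule borel_measurableI_greater)
  fix y
  have "openin (top_of_set S) {x \<in> S. y < f x}"
  proof (subst openin_subopen, intro ballI)
    fix x assume "x \<in> {x \<in> S. y < f x}"
    then have x: "x \<in> S" "y < f x" by auto
    then obtain U where U: "open U" "x \<in> U" "\<forall>z\<in>U. z \<noteq> x \<longrightarrow> z \<in> S \<longrightarrow> y < f z"
      using assms unfolding lsc_on_def eventually_at_topological by blast
    then have "S \<inter> U \<subseteq> {x \<in> S. y < f x}" using x by auto
    with U x show "\<exists>T. openin (top_of_set S) T \<and> x \<in> T \<and> T \<subseteq> {x \<in> S. y < f x}"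
      by (intro exI[of _ "S \<inter> U"]) (auto simp: openin_open)
  qed
  then obtain U where "open U" "{x \<in> S. y < f x} = S \<inter> U" by (auto simp: openin_open)
  then show "{x \<in> space (restrict_space borel S). y < f x} \<in> sets (restrict_space borel S)"
    by (auto simp: space_restrict_space sets_restrict_space)
qed

lemma borel_measurable_usc_on:
  fixes f :: "'a::topological_space \<Rightarrow> real"
  assumes "usc_on S f"
  shows "f \<in> borel_measurable (restrict_space borel S)"
proof -
  have "lsc_on S (\<lambda>x. - f x)"
    unfolding lsc_on_def
  proof (intro ballI allI impI)
    fix x y assume "x \<in> S" "y < - f x"
    then have "f x < - y" by simp
    with \<open>x \<in> S\<close> have "\<forall>\<^sub>F z in at x within S. f z < - y" using assms unfolding usc_on_def by blast
    then show "\<forall>\<^sub>F z in at x within S. y < - f z" by (rule eventually_mono) simp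
  qed
  then have "(\<lambda>x. - f x) \<in> borel_measurable (restrict_space borel S)"
    by (rule borel_measurable_lsc_on)
  then show ?thesis by simp
qed

lemma ext_integral_eq_integral:
  assumes "integrable M f"
  shows "ext_integral M f = ereal (\<integral>x. f x \<partial>M)"
proof -
  from assms obtain r q where rq: "0 \<le> r" "0 \<le> q" "(\<integral>\<^sup>+x. ennreal (f x) \<partial>M) = ennreal r"
    "(\<integral>\<^sup>+x. ennreal (- f x) \<partial>M) = ennreal q" "f \<in> borel_measurable M" "(\<integral>x. f x \<partial>M) = r - q"
    by (rule integrableE)
  then show ?thesis by (simp add: ext_integral_def)
qed

text \<open>The positive part of \<open>l\<close> has finite integral because that of
  \<open>g\<close> has. So either the negative part is infinite and the value is
  \<open>-\<infinity>\<close>, or \<open>l\<close> is integrable.\<close>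

lemma ext_integral_le_integral:
  assumes l: "l \<in> borel_measurable M" and g: "integrable M g"
    and le: "\<And>x. x \<in> space M \<Longrightarrow> l x \<le> g x"
  shows "ext_integral M l \<le> ereal (\<integral>x. g x \<partial>M)"
proof (cases "(\<integral>\<^sup>+x. ennreal (- l x) \<partial>M) = \<infinity>")
  case True
  have "(\<integral>\<^sup>+x. ennreal (l x) \<partial>M) \<le> (\<integral>\<^sup>+x. ennreal (g x) \<partial>M)"
    by (intro nn_integral_mono ennreal_leI le)
  also have "\<dots> < \<infinity>" using g by (simp add: real_integrable_def less_top)
  finally have "enn2ereal (\<integral>\<^sup>+x. ennreal (l x) \<partial>M) \<noteq> \<infinity>"
    by (cases "\<integral>\<^sup>+x. ennreal (l x) \<partial>M") (auto simp: top_ereal_def)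
  then have "ext_integral M l = -\<infinity>"
    using True unfolding ext_integral_def by (cases "\<integral>\<^sup>+x. ennreal (l x) \<partial>M") auto
  then show ?thesis by simp
next
  case False
  have "(\<integral>\<^sup>+x. ennreal (l x) \<partial>M) \<le> (\<integral>\<^sup>+x. ennreal (g x) \<partial>M)"
    by (intro nn_integral_mono ennreal_leI le)
  also have "\<dots> < \<infinity>" using g by (simp add: real_integrable_def less_top)
  finally have "integrable M l" using False l by (auto simp: real_integrable_def)
  then show ?thesis using integral_mono[OF _ g le] by (simp add: ext_integral_eq_integral)
qed

subsection \<open>Plans, couplings and weak duality\<close>

locale discrete_transport_measures = discrete_transport \<Xi> c N p x \<xi>'
  for \<Xi> :: "'a::euclidean_space set" and c and N :: "'k::finite \<Rightarrow> nat" and p x \<xi>' +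
  fixes P :: "'k \<Rightarrow> 'a measure"
  assumes c_lsc: "lsc_on (\<Xi> \<times> \<Xi>) (\<lambda>z. c (fst z) (snd z))"
    and P_borel: "\<And>k. P k \<in> borel_prob \<Xi>"
    and P_discrete: "\<And>k A. A \<in> sets (restrict_space borel \<Xi>) \<Longrightarrow>
      emeasure (P k) A =
        (\<Sum>j\<in>{1..N k}. ennreal (p k j) * emeasure (return (restrict_space borel \<Xi>) (x k j)) A)"
begin

abbreviation borel_Xi where "borel_Xi \<equiv> restrict_space borel \<Xi>"
abbreviation borel_Xi2 where "borel_Xi2 \<equiv> restrict_space borel (\<Xi> \<times> \<Xi>)"

section \<open>Measurability and integrals for the discrete marginals\<close>

lemma sets_P: "sets (P k) = sets borel_Xi"
  using P_borel by (simp add: borel_prob_def)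

lemma measurable_fst_Xi: "fst \<in> borel_Xi2 \<rightarrow>\<^sub>M borel_Xi"
  by (rule measurable_restrict_space2)
    (auto simp: space_restrict_space continuous_on_fst intro: borel_measurable_continuous_on_restrict)

lemma measurable_snd_Xi: "snd \<in> borel_Xi2 \<rightarrow>\<^sub>M borel_Xi"
  by (rule measurable_restrict_space2)
    (auto simp: space_restrict_space continuous_on_snd intro: borel_measurable_continuous_on_restrict)

lemma measurable_Pair_atom: "y \<in> \<Xi> \<Longrightarrow> (\<lambda>\<xi>. (\<xi>, y)) \<in> borel_Xi \<rightarrow>\<^sub>M borel_Xi2"
  by (rule measurable_restrict_space2)
    (auto simp: space_restrict_space intro!: borel_measurable_continuous_on_restrict continuous_intros)

lemma measurable_c: "(\<lambda>z. c (fst z) (snd z)) \<in> borel_measurable borel_Xi2"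
  using c_lsc by (rule borel_measurable_lsc_on)

lemma measurable_c_atom: "y \<in> \<Xi> \<Longrightarrow> (\<lambda>\<xi>. c \<xi> y) \<in> borel_measurable borel_Xi"
  using measurable_comp[OF measurable_Pair_atom measurable_c, of y] by (simp add: o_def)

lemma measurable_atoms: "x k \<in> point_measure {1..N k} f \<rightarrow>\<^sub>M borel_Xi"
  using atoms by (auto simp: measurable_def space_restrict_space space_point_measure sets_point_measure)

text \<open>Atoms with different indices may coincide, so \<open>P k\<close> is treated as the image
  of a measure on indices; integrals then become finite sums over indices.\<close>

lemma P_eq_distr: "P k = distr (point_measure {1..N k} (\<lambda>j. ennreal (p k j))) borel_Xi (x k)"
proof (rule measure_eqI)
  show "sets (P k) = sets (distr (point_measure {1..N k} (\<lambda>j. ennreal (p k j))) borel_Xi (x k))"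
    by (simp add: sets_P)
  fix A assume "A \<in> sets (P k)"
  then have A: "A \<in> sets borel_Xi" by (simp add: sets_P)
  have "emeasure (distr (point_measure {1..N k} (\<lambda>j. ennreal (p k j))) borel_Xi (x k)) A
      = (\<integral>\<^sup>+ j. indicator A (x k j) \<partial>point_measure {1..N k} (\<lambda>j. ennreal (p k j)))"
    using A measurable_atoms by (simp flip: nn_integral_indicator add: nn_integral_distr)
  also have "\<dots> = (\<Sum>j\<in>{1..N k}. ennreal (p k j) * indicator A (x k j))"
    by (rule nn_integral_point_measure_finite) simp
  also have "\<dots> = emeasure (P k) A" using A by (simp add: P_discrete)
  finally show "emeasure (P k) A
      = emeasure (distr (point_measure {1..N k} (\<lambda>j. ennreal (p k j))) borel_Xi (x k)) A" by simp
qed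

lemma integral_P:
  assumes "g \<in> borel_measurable borel_Xi"
  shows "(\<integral>y. g y \<partial>P k) = (\<Sum>j\<in>{1..N k}. p k j * g (x k j))"
  unfolding P_eq_distr integral_distr[OF measurable_atoms assms] using weights_pos
  by (subst lebesgue_integral_point_measure_finite) (auto intro: less_imp_le)

lemma integrable_P:
  assumes "g \<in> borel_measurable borel_Xi"
  shows "integrable (P k) (g :: 'a \<Rightarrow> real)"
  unfolding P_eq_distr
  by (subst integrable_distr_eq[OF measurable_atoms assms]) (simp add: integrable_point_measure_finite)

lemma AE_P: "AE y in P k. y \<in> x k ` {1..N k}"
proof -
  have "x k ` {1..N k} = {y \<in> space borel_Xi. y \<in> x k ` {1..N k}}"
    using atoms by (auto simp: space_restrict_space)
  moreover have "x k ` {1..N k} \<in> sets borel_Xi"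
    using atoms by (auto simp: sets_restrict_space
        intro!: image_eqI[of _ _ "x k ` {1..N k}"] borel_closed finite_imp_closed)
  ultimately show ?thesis
    unfolding P_eq_distr
    by (subst AE_distr_iff[OF measurable_atoms]) (auto simp: AE_point_measure space_restrict_space)
qed

text \<open>List positions, weighted by their masses, form a probability space. On it the location
  and the \<open>k\<close>-th atom are random variables, and their joint law is a coupling with
  \<open>P k\<close>, for all \<open>k\<close> simultaneously.\<close>

lemma plan_in_ambiguity_set:
  assumes plan: "plan l (($) u) v w" and l: "l \<in> borel_measurable borel_Xi"
  obtains Q where "Q \<in> ambiguity_set \<Xi> c P u" "ereal v \<le> ext_integral Q l"
proof -
  define wt where "wt i = fst (w ! i)" for i
  define \<xi> where "\<xi> i = fst (snd (w ! i))" for i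
  define \<alpha> where "\<alpha> i = snd (snd (w ! i))" for i
  let ?I = "{..<length w}"
  define M where "M = point_measure ?I (\<lambda>i. ennreal (wt i))"
  have w: "weighted w" and w_cost: "\<And>k. moment w (cost k) \<le> u $ k"
    and w_marg: "\<And>k j. j \<in> {1..N k} \<Longrightarrow> moment w (at_atom k j) = p k j"
    and w_val: "v \<le> moment w (\<lambda>\<xi> \<alpha>. l \<xi>)" using plan by (auto simp: plan_def)
  have w_nth: "0 \<le> wt i" "\<xi> i \<in> \<Xi>" "\<alpha> i \<in> multi_indices N" if "i \<in> ?I" for i
  proof -
    have "w ! i \<in> set w" using that by simp
    then show "0 \<le> wt i" "\<xi> i \<in> \<Xi>" "\<alpha> i \<in> multi_indices N"
      using w unfolding weighted_def wt_def \<xi>_def \<alpha>_def case_prod_unfold by auto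
  qed
  have w_atom: "x k (\<alpha> i k) \<in> \<Xi>" if "i \<in> ?I" for i k
    by (rule atoms[OF multi_indicesD[OF w_nth(3)[OF that]]])
  have mom: "(\<Sum>i\<in>?I. wt i * f (\<xi> i) (\<alpha> i)) = moment w f" for f
    by (simp add: moment_def sum_list_sum_nth atLeast0LessThan wt_def \<xi>_def \<alpha>_def case_prod_unfold)
  have nn_M: "(\<integral>\<^sup>+ i. ennreal (f (\<xi> i) (\<alpha> i)) \<partial>M) = ennreal (moment w f)"
    if "\<And>\<xi> \<alpha>. \<xi> \<in> \<Xi> \<Longrightarrow> \<alpha> \<in> multi_indices N \<Longrightarrow> 0 \<le> f \<xi> \<alpha>" for f
  proof -
    have "(\<integral>\<^sup>+ i. ennreal (f (\<xi> i) (\<alpha> i)) \<partial>M) = (\<Sum>i\<in>?I. ennreal (wt i) * ennreal (f (\<xi> i) (\<alpha> i)))"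
      unfolding M_def by (rule nn_integral_point_measure_finite) simp
    also have "\<dots> = (\<Sum>i\<in>?I. ennreal (wt i * f (\<xi> i) (\<alpha> i)))"
      by (intro sum.cong refl) (simp add: w_nth ennreal_mult that)
    also have "\<dots> = ennreal (moment w f)"
      unfolding mom[symmetric] by (intro sum_ennreal) (simp add: w_nth that)
    finally show ?thesis .
  qed
  have atom_mom: "moment w (\<lambda>\<xi> \<alpha>. f (\<alpha> k)) = (\<Sum>j\<in>{1..N k}. f j * p k j)" for f k
    unfolding moment_sum_at_atom[OF w, symmetric] by (intro sum.cong refl) (simp add: w_marg)
  have space_M: "space M = ?I" by (simp add: M_def space_point_measure)
  have meas_M: "f \<in> M \<rightarrow>\<^sub>M A" if "\<And>i. i \<in> ?I \<Longrightarrow> f i \<in> space A" for f and A :: "'b measure"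
    using that unfolding M_def
    by (auto simp: measurable_def space_point_measure sets_point_measure)
  have M_prob: "prob_space M"
  proof
    have "emeasure M (space M) = (\<integral>\<^sup>+ i. ennreal 1 \<partial>M)" by simp
    also have "\<dots> = ennreal (moment w (\<lambda>_ _. 1))" by (rule nn_M) simp
    finally show "emeasure M (space M) = 1"
      using atom_mom[of "\<lambda>_. 1" undefined] weights_sum by simp
  qed
  define Q where "Q = distr M borel_Xi \<xi>"
  have xi_meas: "\<xi> \<in> M \<rightarrow>\<^sub>M borel_Xi" by (rule meas_M) (simp add: w_nth space_restrict_space)
  have Q: "Q \<in> borel_prob \<Xi>"
    unfolding Q_def borel_prob_def by (simp add: prob_space.prob_space_distr[OF M_prob xi_meas])
  have "ot_cost \<Xi> c Q (P k) \<le> ennreal (u $ k)" for k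
  proof -
    define f where "f i = (\<xi> i, x k (\<alpha> i k))" for i
    have f: "f \<in> M \<rightarrow>\<^sub>M borel_Xi2"
      by (rule meas_M) (simp add: f_def w_nth space_restrict_space w_atom)
    define \<pi> where "\<pi> = distr M borel_Xi2 f"
    have fst: "distr \<pi> borel_Xi fst = Q"
      unfolding \<pi>_def Q_def by (subst distr_distr[OF measurable_fst_Xi f]) (simp add: o_def f_def)
    have "distr \<pi> borel_Xi snd = distr M borel_Xi (\<lambda>i. x k (\<alpha> i k))"
      unfolding \<pi>_def by (subst distr_distr[OF measurable_snd_Xi f]) (simp add: o_def f_def)
    also have "\<dots> = P k"
    proof (rule measure_eqI)
      fix A assume "A \<in> sets (distr M borel_Xi (\<lambda>i. x k (\<alpha> i k)))"
      then have A: "A \<in> sets borel_Xi" by simp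
      have h: "(\<lambda>i. x k (\<alpha> i k)) \<in> M \<rightarrow>\<^sub>M borel_Xi"
        by (rule meas_M) (simp add: w_nth space_restrict_space w_atom)
      have "emeasure (distr M borel_Xi (\<lambda>i. x k (\<alpha> i k))) A
          = (\<integral>\<^sup>+ i. ennreal (indicator A (x k (\<alpha> i k))) \<partial>M)"
        using A h by (simp flip: nn_integral_indicator add: nn_integral_distr ennreal_indicator)
      also have "\<dots> = ennreal (moment w (\<lambda>\<xi> \<alpha>. indicator A (x k (\<alpha> k))))"
        by (rule nn_M) simp
      also have "\<dots> = ennreal (\<Sum>j\<in>{1..N k}. indicator A (x k j) * p k j)"
        by (subst atom_mom) simp
      also have "\<dots> = (\<Sum>j\<in>{1..N k}. ennreal (indicator A (x k j) * p k j))"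
        using weights_pos
        by (intro sum_ennreal[symmetric] mult_nonneg_nonneg) (auto intro: less_imp_le)
      also have "\<dots> = emeasure (P k) A"
        using A weights_pos[of _ k] unfolding P_discrete[OF A]
        by (intro sum.cong refl) (auto simp: indicator_def)
      finally show "emeasure (distr M borel_Xi (\<lambda>i. x k (\<alpha> i k))) A = emeasure (P k) A" .
    qed (simp add: sets_P)
    finally have "\<pi> \<in> couplings \<Xi> Q (P k)"
      using fst prob_space.prob_space_distr[OF M_prob f]
      unfolding couplings_def borel_prob_def by (simp add: \<pi>_def)
    then have "ot_cost \<Xi> c Q (P k) \<le> (\<integral>\<^sup>+ z. ennreal (c (fst z) (snd z)) \<partial>\<pi>)"
      unfolding ot_cost_def by (rule INF_lower)
    also have "\<dots> = (\<integral>\<^sup>+ i. ennreal (cost k (\<xi> i) (\<alpha> i)) \<partial>M)"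
      unfolding \<pi>_def using measurable_c by (subst nn_integral_distr[OF f]) (auto simp: f_def cost_def)
    also have "\<dots> = ennreal (moment w (cost k))" by (rule nn_M) (rule cost_nonneg)
    also have "\<dots> \<le> ennreal (u $ k)" by (rule ennreal_leI[OF w_cost])
    finally show ?thesis .
  qed
  then have "Q \<in> ambiguity_set \<Xi> c P u"
    using Q by (simp add: ambiguity_set_def ot_ball_def)
  moreover have "ereal v \<le> ext_integral Q l"
  proof -
    have "integrable Q l"
      unfolding Q_def M_def using xi_meas[unfolded M_def]
      by (subst integrable_distr_eq[OF _ l]) (simp_all add: integrable_point_measure_finite)
    moreover have "(\<integral>y. l y \<partial>Q) = moment w (\<lambda>\<xi> \<alpha>. l \<xi>)"
      unfolding Q_def M_def integral_distr[OF xi_meas[unfolded M_def] l] mom[symmetric]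
      by (subst lebesgue_integral_point_measure_finite) (simp_all add: w_nth)
    ultimately show ?thesis using w_val by (simp add: ext_integral_eq_integral)
  qed
  ultimately show ?thesis by (rule that)
qed

section \<open>Envelopes of the dual constraints and their integrals\<close>

definition envelope :: "('k \<Rightarrow> real) \<Rightarrow> ('k \<Rightarrow> nat \<Rightarrow> real) \<Rightarrow> 'k \<Rightarrow> 'a \<Rightarrow> real" where
  "envelope lam \<gamma> k \<xi> = Min ((\<lambda>j. lam k * c \<xi> (x k j) + \<gamma> k j) ` {1..N k})"

lemma indices_nonempty: "{1..N k} \<noteq> {}"
  using weights_sum[of k] by (metis sum.empty zero_neq_one)

lemma measurable_envelope: "envelope lam \<gamma> k \<in> borel_measurable borel_Xi"
  unfolding envelope_def
  by (intro borel_measurable_Min borel_measurable_add borel_measurable_times borel_measurable_const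
      measurable_c_atom atoms) auto

lemma envelope_le: "j \<in> {1..N k} \<Longrightarrow> envelope lam \<gamma> k \<xi> \<le> lam k * c \<xi> (x k j) + \<gamma> k j"
  unfolding envelope_def by (intro Min_le) auto

lemma envelope_attained:
  obtains j where "j \<in> {1..N k}" "envelope lam \<gamma> k \<xi> = lam k * c \<xi> (x k j) + \<gamma> k j"
proof -
  have "envelope lam \<gamma> k \<xi> \<in> (\<lambda>j. lam k * c \<xi> (x k j) + \<gamma> k j) ` {1..N k}"
    unfolding envelope_def using indices_nonempty by (intro Min_in) auto
  then show ?thesis using that by auto
qed

text \<open>The minimizing indices for the various \<open>k\<close> are chosen independently and
  together form one multi-index, where the hypothesis applies.\<close>

lemma le_sum_envelope:
  assumes "\<And>\<alpha>. \<alpha> \<in> multi_indices N \<Longrightarrow> y \<le> (\<Sum>k\<in>UNIV. lam k * cost k \<xi> \<alpha> + \<gamma> k (\<alpha> k))"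
  shows "y \<le> (\<Sum>k\<in>UNIV. envelope lam \<gamma> k \<xi>)"
proof -
  have "\<exists>j. j \<in> {1..N k} \<and> envelope lam \<gamma> k \<xi> = lam k * c \<xi> (x k j) + \<gamma> k j" for k
    using envelope_attained[of k lam \<gamma> \<xi>] by blast
  then obtain \<alpha> where \<alpha>: "\<And>k. \<alpha> k \<in> {1..N k}"
    "\<And>k. envelope lam \<gamma> k \<xi> = lam k * c \<xi> (x k (\<alpha> k)) + \<gamma> k (\<alpha> k)" by metis
  have "\<alpha> \<in> multi_indices N" using \<alpha>(1) by (auto simp: multi_indices_def)
  from assms[OF this] show ?thesis by (simp add: cost_def \<alpha>(2))
qed

text \<open>On the support of the second marginal, the envelope at the first coordinate is at most
  the weighted cost plus a function of the second coordinate; integrate this against the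
  coupling.\<close>

lemma envelope_coupling:
  assumes pi: "\<pi> \<in> couplings \<Xi> Q (P k)" and lam: "0 \<le> lam k"
    and cost: "(\<integral>\<^sup>+ z. ennreal (c (fst z) (snd z)) \<partial>\<pi>) \<le> ennreal r" and r: "0 \<le> r"
  shows "integrable Q (envelope lam \<gamma> k)"
    and "(\<integral>\<xi>. envelope lam \<gamma> k \<xi> \<partial>Q) \<le> r * lam k + (\<Sum>j\<in>{1..N k}. p k j * \<gamma> k j)"
proof -
  have sets_pi: "sets \<pi> = sets borel_Xi2" and pi_prob: "prob_space \<pi>"
    and Q_eq: "distr \<pi> borel_Xi fst = Q" and P_eq: "distr \<pi> borel_Xi snd = P k"
    using pi by (auto simp: couplings_def borel_prob_def)
  note cong = measurable_cong_sets[OF sets_pi refl]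
  have fst: "fst \<in> \<pi> \<rightarrow>\<^sub>M borel_Xi" and snd: "snd \<in> \<pi> \<rightarrow>\<^sub>M borel_Xi"
    and c: "(\<lambda>z. c (fst z) (snd z)) \<in> borel_measurable \<pi>"
    using measurable_fst_Xi measurable_snd_Xi measurable_c by (simp_all add: cong)
  have space_pi: "space \<pi> = \<Xi> \<times> \<Xi>"
    using sets_eq_imp_space_eq[OF sets_pi] by (simp add: space_restrict_space)
  have c_nn: "AE z in \<pi>. 0 \<le> c (fst z) (snd z)"
    by (rule AE_I2) (auto simp: space_pi c_nonneg)
  have c_int: "integrable \<pi> (\<lambda>z. c (fst z) (snd z))"
    using cost by (intro integrableI_nonneg c c_nn) (auto intro: le_less_trans)
  have c_le: "(\<integral>z. c (fst z) (snd z) \<partial>\<pi>) \<le> r"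
    using cost r nn_integral_eq_integral[OF c_int c_nn] by simp
  define X where "X = x k ` {1..N k}"
  \<comment> \<open>Coinciding atoms may carry different values of \<open>\<gamma>\<close>. The
    least of them is a function of the atom and still bounds the envelope, since the envelope lies
    below every \<open>j\<close>-term.\<close>
  define \<Gamma> where "\<Gamma> y = (if y \<in> X then Min (\<gamma> k ` {j \<in> {1..N k}. x k j = y}) else 0)" for y
  have Gam_le: "\<Gamma> (x k j) \<le> \<gamma> k j" if "j \<in> {1..N k}" for j
    unfolding \<Gamma>_def X_def using that by (auto intro: Min_le)
  have Gam_attained: "\<exists>j\<in>{1..N k}. x k j = y \<and> \<Gamma> y = \<gamma> k j" if "y \<in> X" for y
  proof -
    have "Min (\<gamma> k ` {j \<in> {1..N k}. x k j = y}) \<in> \<gamma> k ` {j \<in> {1..N k}. x k j = y}"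
      using that by (intro Min_in) (auto simp: X_def)
    then show ?thesis using that by (auto simp: \<Gamma>_def)
  qed
  have Gam: "\<Gamma> \<in> borel_measurable borel_Xi"
  proof (rule measurable_discrete_difference[of "\<lambda>_. 0"])
    show "countable X" unfolding X_def by (intro countable_finite) auto
    show "{y} \<in> sets borel_Xi" if "y \<in> X" for y
      using that atoms by (auto simp: X_def sets_restrict_space intro!: image_eqI[of _ _ "{y}"])
  qed (auto simp: \<Gamma>_def)
  define B where "B = (\<Sum>j\<in>{1..N k}. \<bar>\<gamma> k j\<bar>)"
  have B: "\<bar>\<gamma> k j\<bar> \<le> B" if "j \<in> {1..N k}" for j
    unfolding B_def using that by (intro member_le_sum) auto
  have AE_X: "AE z in \<pi>. snd z \<in> X"
    using AE_P[of k] unfolding P_eq[symmetric] X_def by (rule AE_distrD[OF snd])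
  have env_le: "AE z in \<pi>. envelope lam \<gamma> k (fst z) \<le> lam k * c (fst z) (snd z) + \<Gamma> (snd z)"
    using AE_X
  proof eventually_elim
    case (elim z)
    then obtain j where j: "j \<in> {1..N k}" "x k j = snd z" "\<Gamma> (snd z) = \<gamma> k j"
      using Gam_attained by blast
    then show ?case using envelope_le[OF j(1), of lam \<gamma> "fst z"] by simp
  qed
  \<comment> \<open>The upper bound comes from the second coordinate, the lower bound -
    \<open>B\<close> from the minimizing index and nonnegative costs.\<close>
  have env_bound: "AE z in \<pi>. norm (envelope lam \<gamma> k (fst z)) \<le> norm (lam k * c (fst z) (snd z) + B)"
    using env_le AE_X AE_space
  proof eventually_elim
    case (elim z)
    then have z: "fst z \<in> \<Xi>" "snd z \<in> \<Xi>" by (auto simp: space_pi)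
    obtain j where j: "j \<in> {1..N k}" "\<Gamma> (snd z) = \<gamma> k j" using Gam_attained elim by blast
    obtain i where i: "i \<in> {1..N k}"
      "envelope lam \<gamma> k (fst z) = lam k * c (fst z) (x k i) + \<gamma> k i"
      by (rule envelope_attained)
    have "0 \<le> lam k * c (fst z) (x k i)" "0 \<le> lam k * c (fst z) (snd z)"
      using lam z i atoms by (auto intro!: mult_nonneg_nonneg c_nonneg)
    then show ?case using elim(1) i(2) j(2) B[OF i(1)] B[OF j(1)] by simp
  qed
  have env_pi: "(\<lambda>z. envelope lam \<gamma> k (fst z)) \<in> borel_measurable \<pi>"
    using fst measurable_envelope by (rule measurable_compose)
  have Gam_pi: "integrable \<pi> (\<lambda>z. \<Gamma> (snd z))"
    using integrable_P[OF Gam, of k] unfolding P_eq[symmetric] integrable_distr_eq[OF snd Gam] .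
  interpret pi: prob_space \<pi> by (rule pi_prob)
  have env_int: "integrable \<pi> (\<lambda>z. envelope lam \<gamma> k (fst z))"
    by (rule Bochner_Integration.integrable_bound[OF _ env_pi env_bound]) (simp add: c_int)
  then show "integrable Q (envelope lam \<gamma> k)"
    unfolding Q_eq[symmetric] integrable_distr_eq[OF fst measurable_envelope] .
  have "(\<integral>\<xi>. envelope lam \<gamma> k \<xi> \<partial>Q) = (\<integral>z. envelope lam \<gamma> k (fst z) \<partial>\<pi>)"
    unfolding Q_eq[symmetric] by (rule integral_distr[OF fst measurable_envelope])
  also have "\<dots> \<le> (\<integral>z. lam k * c (fst z) (snd z) + \<Gamma> (snd z) \<partial>\<pi>)"
    by (intro integral_mono_AE env_int env_le Bochner_Integration.integrable_add
        integrable_mult_right c_int Gam_pi)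
  also have "\<dots> = lam k * (\<integral>z. c (fst z) (snd z) \<partial>\<pi>) + (\<integral>z. \<Gamma> (snd z) \<partial>\<pi>)"
    using c_int Gam_pi by simp
  also have "(\<integral>z. \<Gamma> (snd z) \<partial>\<pi>) = (\<integral>y. \<Gamma> y \<partial>P k)"
    unfolding P_eq[symmetric] by (rule integral_distr[OF snd Gam, symmetric])
  also have "\<dots> = (\<Sum>j\<in>{1..N k}. p k j * \<Gamma> (x k j))" by (rule integral_P[OF Gam])
  also have "\<dots> \<le> (\<Sum>j\<in>{1..N k}. p k j * \<gamma> k j)"
    using weights_pos[of _ k] by (intro sum_mono mult_left_mono Gam_le) (auto intro: less_imp_le)
  also have "lam k * (\<integral>z. c (fst z) (snd z) \<partial>\<pi>) \<le> r * lam k"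
    using mult_left_mono[OF c_le lam] by (simp add: mult.commute)
  finally show "(\<integral>\<xi>. envelope lam \<gamma> k \<xi> \<partial>Q) \<le> r * lam k + (\<Sum>j\<in>{1..N k}. p k j * \<gamma> k j)"
    by simp
qed

text \<open>Attainment of the transport infimum is avoided: couplings of cost at most
  \<open>u $ k\<close> + e exist for every e > 0, and e tends to 0 in the bound.\<close>

lemma envelope_ambiguity:
  assumes Q: "Q \<in> ambiguity_set \<Xi> c P u" and u: "0 \<le> u $ k" and lam: "0 \<le> lam k"
  shows "integrable Q (envelope lam \<gamma> k)"
    and "(\<integral>\<xi>. envelope lam \<gamma> k \<xi> \<partial>Q) \<le> u $ k * lam k + (\<Sum>j\<in>{1..N k}. p k j * \<gamma> k j)"
proof -
  have ex: "\<exists>\<pi>\<in>couplings \<Xi> Q (P k).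
      (\<integral>\<^sup>+ z. ennreal (c (fst z) (snd z)) \<partial>\<pi>) \<le> ennreal (u $ k + e)" if "0 < e" for e
  proof -
    have "ot_cost \<Xi> c Q (P k) \<le> ennreal (u $ k)"
      using Q by (simp add: ambiguity_set_def ot_ball_def)
    also have "\<dots> < ennreal (u $ k + e)" using u that by (simp add: ennreal_less_iff)
    finally show ?thesis unfolding ot_cost_def INF_less_iff by (auto intro: less_imp_le)
  qed
  obtain \<pi> where pi: "\<pi> \<in> couplings \<Xi> Q (P k)"
    "(\<integral>\<^sup>+ z. ennreal (c (fst z) (snd z)) \<partial>\<pi>) \<le> ennreal (u $ k + 1)" using ex[of 1] by auto
  then show "integrable Q (envelope lam \<gamma> k)"
    using envelope_coupling(1)[where lam = lam and k = k, OF pi(1) lam pi(2)] u by simp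
  show "(\<integral>\<xi>. envelope lam \<gamma> k \<xi> \<partial>Q) \<le> u $ k * lam k + (\<Sum>j\<in>{1..N k}. p k j * \<gamma> k j)"
  proof (rule field_le_epsilon)
    fix e :: real assume e: "0 < e"
    \<comment> \<open>The summand 1 keeps the quotient meaningful when \<open>lam k\<close> =
      0.\<close>
    define d where "d = e / (lam k + 1)"
    have d: "0 < d" using e lam by (simp add: d_def)
    obtain \<pi> where pi: "\<pi> \<in> couplings \<Xi> Q (P k)"
      "(\<integral>\<^sup>+ z. ennreal (c (fst z) (snd z)) \<partial>\<pi>) \<le> ennreal (u $ k + d)" using ex[OF d] by blast
    have "d * lam k \<le> d * (lam k + 1)" using d by simp
    also have "\<dots> = e" using lam by (simp add: d_def)
    finally have "(u $ k + d) * lam k \<le> u $ k * lam k + e" by (simp add: algebra_simps)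
    then show "(\<integral>\<xi>. envelope lam \<gamma> k \<xi> \<partial>Q)
        \<le> u $ k * lam k + (\<Sum>j\<in>{1..N k}. p k j * \<gamma> k j) + e"
      using envelope_coupling(2)[where \<gamma> = \<gamma> and lam = lam and k = k, OF pi(1) lam pi(2)] u d by simp
  qed
qed

lemma weak_duality:
  assumes Q: "Q \<in> ambiguity_set \<Xi> c P u" and u: "\<And>k. 0 \<le> u $ k" and lam: "\<And>k. 0 \<le> lam k"
    and l: "l \<in> borel_measurable borel_Xi"
    and le: "\<And>\<xi> \<alpha>. \<xi> \<in> \<Xi> \<Longrightarrow> \<alpha> \<in> multi_indices N
        \<Longrightarrow> l \<xi> \<le> (\<Sum>k\<in>UNIV. lam k * cost k \<xi> \<alpha> + \<gamma> k (\<alpha> k))"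
  shows "ext_integral Q l
    \<le> ereal ((\<Sum>k\<in>UNIV. u $ k * lam k) + (\<Sum>k\<in>UNIV. \<Sum>j\<in>{1..N k}. p k j * \<gamma> k j))"
proof -
  have sets_Q: "sets Q = sets borel_Xi"
    using Q by (auto simp: ambiguity_set_def ot_ball_def borel_prob_def)
  have "ext_integral Q l \<le> ereal (\<integral>\<xi>. (\<Sum>k\<in>UNIV. envelope lam \<gamma> k \<xi>) \<partial>Q)"
  proof (rule ext_integral_le_integral)
    show "l \<in> borel_measurable Q" using l by (simp add: measurable_cong_sets[OF sets_Q refl])
    show "integrable Q (\<lambda>\<xi>. \<Sum>k\<in>UNIV. envelope lam \<gamma> k \<xi>)"
      by (intro Bochner_Integration.integrable_sum envelope_ambiguity(1)[OF Q u lam])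
    show "l \<xi> \<le> (\<Sum>k\<in>UNIV. envelope lam \<gamma> k \<xi>)" if "\<xi> \<in> space Q" for \<xi>
      using that sets_eq_imp_space_eq[OF sets_Q]
      by (intro le_sum_envelope le) (simp_all add: space_restrict_space)
  qed
  also have "(\<integral>\<xi>. (\<Sum>k\<in>UNIV. envelope lam \<gamma> k \<xi>) \<partial>Q) = (\<Sum>k\<in>UNIV. \<integral>\<xi>. envelope lam \<gamma> k \<xi> \<partial>Q)"
    by (intro Bochner_Integration.integral_sum envelope_ambiguity(1)[OF Q u lam])
  also have "\<dots> \<le> (\<Sum>k\<in>UNIV. u $ k * lam k + (\<Sum>j\<in>{1..N k}. p k j * \<gamma> k j))"
    by (intro sum_mono envelope_ambiguity(2)[OF Q u lam])
  finally show ?thesis by (simp add: sum.distrib)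
qed

subsection \<open>Strong duality\<close>

lemma dual_feasible_iff:
  "(lam, \<gamma>) \<in> dual_feasible \<Xi> c N x l \<longleftrightarrow> (\<forall>k. 0 \<le> lam $ k) \<and>
    (\<forall>\<alpha>\<in>multi_indices N. \<forall>\<xi>\<in>\<Xi>. l \<xi> \<le> (\<Sum>k\<in>UNIV. lam $ k * cost k \<xi> \<alpha> + \<gamma> k (\<alpha> k)))"
  by (simp add: dual_feasible_def SUP_le_iff cost_def sum.distrib algebra_simps)

lemma primal_le_dual:
  assumes l: "l \<in> borel_measurable borel_Xi" and eps: "\<And>k. 0 \<le> \<epsilon> $ k"
  shows "primal_value \<Xi> c P l \<epsilon> \<le> dual_value \<Xi> c N p x l \<epsilon>"
  unfolding primal_value_def dual_value_def
proof (intro SUP_least INF_greatest)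
  fix Q z assume Q: "Q \<in> ambiguity_set \<Xi> c P \<epsilon>" and z: "z \<in> dual_feasible \<Xi> c N x l"
  obtain lam \<gamma> where "z = (lam, \<gamma>)" by fastforce
  with z have "\<And>k. 0 \<le> lam $ k" "\<And>\<xi> \<alpha>. \<xi> \<in> \<Xi> \<Longrightarrow> \<alpha> \<in> multi_indices N
      \<Longrightarrow> l \<xi> \<le> (\<Sum>k\<in>UNIV. lam $ k * cost k \<xi> \<alpha> + \<gamma> k (\<alpha> k))"
    by (auto simp: dual_feasible_iff)
  from weak_duality[where lam = "($) lam", OF Q eps this(1) l this(2)] \<open>z = (lam, \<gamma>)\<close>
  show "ext_integral Q l \<le> (case z of (lam, \<gamma>) \<Rightarrow>
      ereal ((\<Sum>k\<in>UNIV. \<epsilon> $ k * lam $ k) + (\<Sum>k\<in>UNIV. \<Sum>j\<in>{1..N k}. p k j * \<gamma> k j)))"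
    by simp
qed

text \<open>For zero loss, weak duality would bound 0 by a negative number.\<close>

lemma empty_ambiguity_set_if_separated:
  assumes eps: "\<And>k. 0 \<le> \<epsilon> $ k" and lam: "\<And>k. 0 \<le> lam k"
    and le: "\<And>\<xi> \<alpha>. \<xi> \<in> \<Xi> \<Longrightarrow> \<alpha> \<in> multi_indices N
        \<Longrightarrow> 0 \<le> (\<Sum>k\<in>UNIV. lam k * cost k \<xi> \<alpha> + \<gamma> k (\<alpha> k))"
    and neg: "(\<Sum>k\<in>UNIV. \<epsilon> $ k * lam k) + (\<Sum>k\<in>UNIV. \<Sum>j\<in>{1..N k}. p k j * \<gamma> k j) < 0"
  shows "ambiguity_set \<Xi> c P \<epsilon> = {}"
proof (rule ccontr)
  assume "ambiguity_set \<Xi> c P \<epsilon> \<noteq> {}"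
  then obtain Q where Q: "Q \<in> ambiguity_set \<Xi> c P \<epsilon>" by blast
  from weak_duality[where l = "\<lambda>_. 0", OF Q eps lam _ le] neg
  show False by (simp add: ext_integral_def)
qed

text \<open>The pair (\<open>lam\<close>, \<open>\<gamma>\<close>) is a recession direction of the
  dual feasible set along which the objective decreases.\<close>

lemma dual_unbounded_if_separated:
  assumes lam: "\<And>k. 0 \<le> lam k"
    and le: "\<And>\<xi> \<alpha>. \<xi> \<in> \<Xi> \<Longrightarrow> \<alpha> \<in> multi_indices N
        \<Longrightarrow> 0 \<le> (\<Sum>k\<in>UNIV. lam k * cost k \<xi> \<alpha> + \<gamma> k (\<alpha> k))"
    and neg: "(\<Sum>k\<in>UNIV. \<epsilon> $ k * lam k) + (\<Sum>k\<in>UNIV. \<Sum>j\<in>{1..N k}. p k j * \<gamma> k j) < 0"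
    and feas: "dual_feasible \<Xi> c N x l \<noteq> {}"
  shows "dual_value \<Xi> c N p x l \<epsilon> = - \<infinity>"
proof (rule ereal_bot)
  fix B :: real
  define J where "J lam \<gamma> = (\<Sum>k\<in>UNIV. \<epsilon> $ k * lam k) + (\<Sum>k\<in>UNIV. \<Sum>j\<in>{1..N k}. p k j * \<gamma> k j)"
    for lam \<gamma>
  obtain lam0 \<gamma>0 where feas0: "(lam0, \<gamma>0) \<in> dual_feasible \<Xi> c N x l" using feas by auto
  \<comment> \<open>The step length after which the objective has dropped from its value at the
    feasible point to at most \<open>B\<close>.\<close>
  define t where "t = max 0 ((J (($) lam0) \<gamma>0 - B) / - J lam \<gamma>)"
  have t: "0 \<le> t" "J (($) lam0) \<gamma>0 - B \<le> t * - J lam \<gamma>"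
    using neg unfolding J_def[symmetric] by (auto simp: t_def max_def field_simps)
  define lam1 :: "real ^ 'k" where "lam1 = (\<chi> k. lam0 $ k + t * lam k)"
  define \<gamma>1 where "\<gamma>1 k j = \<gamma>0 k j + t * \<gamma> k j" for k j
  have "(lam1, \<gamma>1) \<in> dual_feasible \<Xi> c N x l"
    unfolding dual_feasible_iff
  proof (intro conjI allI ballI)
    show "0 \<le> lam1 $ k" for k
      using feas0 t lam unfolding dual_feasible_iff by (simp add: lam1_def)
    fix \<alpha> \<xi> assume *: "\<alpha> \<in> multi_indices N" "\<xi> \<in> \<Xi>"
    have "l \<xi> \<le> (\<Sum>k\<in>UNIV. lam0 $ k * cost k \<xi> \<alpha> + \<gamma>0 k (\<alpha> k))"
      using feas0 * unfolding dual_feasible_iff by blast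
    moreover have "0 \<le> t * (\<Sum>k\<in>UNIV. lam k * cost k \<xi> \<alpha> + \<gamma> k (\<alpha> k))"
      using t le * by (intro mult_nonneg_nonneg) auto
    ultimately show "l \<xi> \<le> (\<Sum>k\<in>UNIV. lam1 $ k * cost k \<xi> \<alpha> + \<gamma>1 k (\<alpha> k))"
      by (simp add: lam1_def \<gamma>1_def sum.distrib algebra_simps flip: sum_distrib_left)
  qed
  then have "dual_value \<Xi> c N p x l \<epsilon> \<le> ereal (J (($) lam1) \<gamma>1)"
    unfolding dual_value_def J_def by (rule INF_lower2) simp
  also have "J (($) lam1) \<gamma>1 = J (($) lam0) \<gamma>0 + t * J lam \<gamma>"
    by (simp add: J_def lam1_def \<gamma>1_def sum.distrib sum_distrib_left algebra_simps)
  also have "\<dots> \<le> B" using t by simp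
  finally show "dual_value \<Xi> c N p x l \<epsilon> \<le> ereal B" by simp
qed

lemma separation_or_plan:
  fixes l :: "'a \<Rightarrow> real"
  obtains (separated) lam \<gamma> \<tau> where "\<And>k. 0 \<le> lam k" "0 \<le> \<tau>"
      "\<And>\<xi> \<alpha>. \<xi> \<in> \<Xi> \<Longrightarrow> \<alpha> \<in> multi_indices N
        \<Longrightarrow> \<tau> * l \<xi> \<le> (\<Sum>k\<in>UNIV. lam k * cost k \<xi> \<alpha> + \<gamma> k (\<alpha> k))"
      "(\<Sum>k\<in>UNIV. u k * lam k) + (\<Sum>k\<in>UNIV. \<Sum>j\<in>{1..N k}. p k j * \<gamma> k j) < \<tau> * v"
  | (plan) "\<And>\<delta>. 0 < \<delta> \<Longrightarrow> \<exists>w. plan l (\<lambda>k. u k + \<delta>) (v - \<delta>) w"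
  by (rule separation_or_approximate_moments[of l u v])
    (blast intro: exact_plan_of_approximate)+

text \<open>
  A plan with strictly smaller costs plays the role of a Slater point: mixing a little of it into
  a nearly feasible plan of value nearly \<open>v\<close> restores feasibility.
\<close>
lemma dual_le_primal_if_slater:
  assumes l: "l \<in> borel_measurable borel_Xi" and s: "0 < s"
    and slater: "plan l (\<lambda>k. \<epsilon> $ k - s) v0 w0"
  shows "dual_value \<Xi> c N p x l \<epsilon> \<le> primal_value \<Xi> c P l \<epsilon>"
proof (rule dense_ge)
  fix z assume z: "primal_value \<Xi> c P l \<epsilon> < z"
  show "dual_value \<Xi> c N p x l \<epsilon> \<le> z"
  proof (cases z)
    case (real v)
    show ?thesis
    proof (cases rule: separation_or_plan[of l "($) \<epsilon>" v])
      case (separated lam \<gamma> \<tau>)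
      \<comment> \<open>Otherwise pairing with the Slater plan contradicts the strict
        separation.\<close>
      have "\<tau> \<noteq> 0"
      proof
        assume "\<tau> = 0"
        have "(\<Sum>k\<in>UNIV. (\<epsilon> $ k - s) * lam k) \<le> (\<Sum>k\<in>UNIV. \<epsilon> $ k * lam k)"
          using s separated(1) by (intro sum_mono mult_right_mono) auto
        then show False
          using plan_pairing[OF slater separated(1,2,3)] separated(4) \<open>\<tau> = 0\<close> by simp
      qed
      then have tau: "0 < \<tau>" using separated(2) by simp
      have "((\<chi> k. lam k / \<tau>), (\<lambda>k j. \<gamma> k j / \<tau>)) \<in> dual_feasible \<Xi> c N x l"
        unfolding dual_feasible_iff
      proof (intro conjI allI ballI)
        show "0 \<le> (\<chi> k. lam k / \<tau>) $ k" for k using separated(1) tau by simp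
        fix \<alpha> \<xi> assume "\<alpha> \<in> multi_indices N" "\<xi> \<in> \<Xi>"
        then have "l \<xi> \<le> (\<Sum>k\<in>UNIV. lam k * cost k \<xi> \<alpha> + \<gamma> k (\<alpha> k)) / \<tau>"
          using separated(3) tau by (simp add: pos_le_divide_eq mult.commute)
        then show "l \<xi> \<le> (\<Sum>k\<in>UNIV. (\<chi> k. lam k / \<tau>) $ k * cost k \<xi> \<alpha> + \<gamma> k (\<alpha> k) / \<tau>)"
          by (simp add: sum_divide_distrib add_divide_distrib)
      qed
      then have "dual_value \<Xi> c N p x l \<epsilon> \<le> ereal ((\<Sum>k\<in>UNIV. \<epsilon> $ k * (lam k / \<tau>))
          + (\<Sum>k\<in>UNIV. \<Sum>j\<in>{1..N k}. p k j * (\<gamma> k j / \<tau>)))"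
        unfolding dual_value_def by (rule INF_lower2) simp
      also have "\<dots> = ereal (((\<Sum>k\<in>UNIV. \<epsilon> $ k * lam k)
          + (\<Sum>k\<in>UNIV. \<Sum>j\<in>{1..N k}. p k j * \<gamma> k j)) / \<tau>)"
        by (simp add: sum_divide_distrib add_divide_distrib)
      also have "\<dots> \<le> ereal v"
        using separated(4) tau by (simp add: pos_divide_le_eq mult.commute)
      finally show ?thesis by (simp add: real)
    next
      case plan
      \<comment> \<open>The gap between \<open>v1\<close> and \<open>v\<close> is the loss of value
        that the mixing may cause.\<close>
      obtain v1 where v1: "primal_value \<Xi> c P l \<epsilon> < ereal v1" "v1 < v"
        using ereal_dense2[OF z] real by auto
      define t where "t = min (1/2) ((v - v1) / (1 + \<bar>v + s - v0\<bar>))"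
      have t: "0 < t" "t < 1" using v1 by (auto simp: t_def)
      have "t * (v + s - v0) \<le> t * (1 + \<bar>v + s - v0\<bar>)" using t by (intro mult_left_mono) auto
      also have "\<dots> \<le> (v - v1) / (1 + \<bar>v + s - v0\<bar>) * (1 + \<bar>v + s - v0\<bar>)"
        by (intro mult_right_mono) (auto simp: t_def)
      also have "\<dots> = v - v1" by (simp add: add_nonneg_eq_0_iff)
      finally have t_le: "t * (v + s - v0) \<le> v - v1" .
      \<comment> \<open>Makes the violation (1 - t) \<open>\<delta>\<close> of each radius equal to
        the gain t \<open>s\<close> from the Slater plan.\<close>
      define \<delta> where "\<delta> = t * s / (1 - t)"
      have delta: "0 < \<delta>" "(1 - t) * \<delta> = t * s" using t s by (auto simp: \<delta>_def)
      obtain w where w: "plan l (\<lambda>k. \<epsilon> $ k + \<delta>) (v - \<delta>) w" using plan[OF delta(1)] by blast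
      have radii: "(\<lambda>k. (1 - t) * (\<epsilon> $ k + \<delta>) + t * (\<epsilon> $ k - s)) = ($) \<epsilon>"
        using delta(2) by (auto simp: fun_eq_iff algebra_simps)
      obtain Q where Q: "Q \<in> ambiguity_set \<Xi> c P \<epsilon>"
        "ereal ((1 - t) * (v - \<delta>) + t * v0) \<le> ext_integral Q l"
        using plan_in_ambiguity_set[OF plan_mix[OF w slater, of t, unfolded radii] l] t by auto
      have "(1 - t) * (v - \<delta>) + t * v0 = v - t * v - t * s + t * v0"
        using delta(2) by (simp add: algebra_simps)
      then have "v1 \<le> (1 - t) * (v - \<delta>) + t * v0" using t_le by (simp add: algebra_simps)
      then have "ereal v1 \<le> ext_integral Q l" using Q(2) by (meson ereal_less_eq(3) order_trans)
      also have "\<dots> \<le> primal_value \<Xi> c P l \<epsilon>"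
        unfolding primal_value_def by (rule SUP_upper[OF Q(1)])
      finally show ?thesis using v1 by simp
    qed
  qed (use z in auto)
qed

lemma strong_duality:
  assumes l: "l \<in> borel_measurable borel_Xi" and eps: "\<And>k. 0 \<le> \<epsilon> $ k"
    and feas: "dual_feasible \<Xi> c N x l \<noteq> {}" and frontier: "\<epsilon> \<notin> frontier (feasible_radii \<Xi> c P)"
  shows "primal_value \<Xi> c P l \<epsilon> = dual_value \<Xi> c N p x l \<epsilon>"
proof (cases rule: separation_or_plan[of "\<lambda>_. 0" "($) \<epsilon>" 0])
  case (separated lam \<gamma> \<tau>)
  have "ambiguity_set \<Xi> c P \<epsilon> = {}"
    using separated by (intro empty_ambiguity_set_if_separated[OF eps separated(1)]) auto
  moreover have "dual_value \<Xi> c N p x l \<epsilon> = - \<infinity>"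
    using separated by (intro dual_unbounded_if_separated[OF separated(1) _ _ feas]) auto
  ultimately show ?thesis by (simp add: primal_value_def bot_ereal_def)
next
  case plan
  let ?E = "feasible_radii \<Xi> c P"
  \<comment> \<open>The vector 1 has all entries equal to one: every radius is raised at once, and
    \<open>\<epsilon>\<close> is a limit of feasible radii.\<close>
  have "\<epsilon> + \<delta> *\<^sub>R 1 \<in> ?E" if delta: "0 < \<delta>" for \<delta>
  proof -
    have "(\<lambda>k. \<epsilon> $ k + \<delta>) = ($) (\<epsilon> + \<delta> *\<^sub>R 1)" by (simp add: fun_eq_iff)
    then obtain w where "plan (\<lambda>_. 0) (($) (\<epsilon> + \<delta> *\<^sub>R 1)) (0 - \<delta>) w"
      using plan[OF delta] by metis
    then obtain Q where "Q \<in> ambiguity_set \<Xi> c P (\<epsilon> + \<delta> *\<^sub>R 1)"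
      by (rule plan_in_ambiguity_set) auto
    then show ?thesis using eps delta by (auto simp: feasible_radii_def)
  qed
  then have "\<forall>\<^sub>F \<delta> in at_right 0. \<epsilon> + \<delta> *\<^sub>R 1 \<in> closure ?E"
    using closure_subset by (intro eventually_at_rightI[of 0 1]) auto
  moreover have "((\<lambda>\<delta>. \<epsilon> + \<delta> *\<^sub>R 1) \<longlongrightarrow> \<epsilon> + 0 *\<^sub>R 1) (at_right 0)" by (intro tendsto_intros)
  ultimately have "\<epsilon> \<in> closure ?E"
    using Lim_in_closed_set[OF closed_closure _ trivial_limit_at_right_real] by fastforce
  then have "\<epsilon> \<in> interior ?E" using frontier by (simp add: frontier_def)
  moreover have "((\<lambda>\<delta>. \<epsilon> - \<delta> *\<^sub>R 1) \<longlongrightarrow> \<epsilon> - 0 *\<^sub>R 1) (at_right 0)" by (intro tendsto_intros)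
  ultimately have "\<forall>\<^sub>F \<delta> in at_right 0. \<epsilon> - \<delta> *\<^sub>R 1 \<in> interior ?E"
    by (intro topological_tendstoD) auto
  then have "\<forall>\<^sub>F \<delta>::real in at_right 0. \<epsilon> - \<delta> *\<^sub>R 1 \<in> interior ?E \<and> 0 < \<delta>"
    using eventually_at_right_less by (rule eventually_conj)
  then obtain s :: real where s: "0 < s" "\<epsilon> - s *\<^sub>R 1 \<in> ?E"
    using eventually_happens'[OF trivial_limit_at_right_real] interior_subset by blast
  define \<epsilon>' where "\<epsilon>' = \<epsilon> - s *\<^sub>R 1"
  have eps': "\<And>k. 0 \<le> \<epsilon>' $ k" "ambiguity_set \<Xi> c P \<epsilon>' \<noteq> {}"
    using s(2) unfolding feasible_radii_def \<epsilon>'_def by auto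
  \<comment> \<open>Feasibility at the lowered radii provides only some distribution. It excludes
    separation there, so the dichotomy gives a finitely supported plan, at the price of half of the
    margin \<open>s\<close>.\<close>
  have "\<exists>w. plan (\<lambda>_. 0) (\<lambda>k. \<epsilon>' $ k + s / 2) (0 - s / 2) w"
  proof (cases rule: separation_or_plan[of "\<lambda>_. 0" "($) \<epsilon>'" 0])
    case (separated lam \<gamma> \<tau>)
    have "ambiguity_set \<Xi> c P \<epsilon>' = {}"
      using separated by (intro empty_ambiguity_set_if_separated[OF eps'(1) separated(1)]) auto
    with eps'(2) show ?thesis by simp
  next
    case plan
    then show ?thesis using s(1) by simp
  qed
  then obtain w where "plan (\<lambda>_. 0) (\<lambda>k. \<epsilon>' $ k + s / 2) (0 - s / 2) w" by blast
  \<comment> \<open>Only the radii matter for a Slater point; its value for the actual loss may be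
    anything.\<close>
  then have "plan l (\<lambda>k. \<epsilon> $ k - s / 2) (moment w (\<lambda>\<xi> \<alpha>. l \<xi>)) w"
    by (simp add: plan_def \<epsilon>'_def)
  then have "dual_value \<Xi> c N p x l \<epsilon> \<le> primal_value \<Xi> c P l \<epsilon>"
    using dual_le_primal_if_slater[OF l, of "s / 2"] s(1) by simp
  then show ?thesis using primal_le_dual[OF l eps] by simp
qed

text \<open>
  Since \<open>q' \<le> q\<close>, a large multiple of \<open>c \<xi> (x k j) \<ge> \<rho> \<xi> (x k j) powr q\<close> absorbs the growth of the
  loss for any single \<open>k\<close>.
\<close>
lemma dual_feasible_nonempty:
  fixes \<rho> :: "'a \<Rightarrow> 'a \<Rightarrow> real"
  assumes metric: "Metric_space \<Xi> \<rho>"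
    and c_ge: "\<And>\<xi>\<^sub>1 \<xi>\<^sub>2. \<xi>\<^sub>1 \<in> \<Xi> \<Longrightarrow> \<xi>\<^sub>2 \<in> \<Xi> \<Longrightarrow> \<rho> \<xi>\<^sub>1 \<xi>\<^sub>2 powr q \<le> c \<xi>\<^sub>1 \<xi>\<^sub>2"
    and exponents: "1 \<le> q'" "q' \<le> q" and g: "0 < g'"
    and growth: "\<And>\<xi>. \<xi> \<in> \<Xi> \<Longrightarrow> l \<xi> \<le> g' * (1 + \<rho> \<xi> \<xi>' powr q')"
  shows "dual_feasible \<Xi> c N x l \<noteq> {}"
proof -
  interpret Metric_space \<Xi> \<rho> by (rule metric)
  define k0 where "k0 = (undefined :: 'k)"
  define D where "D = (\<Sum>j\<in>{1..N k0}. \<rho> (x k0 j) \<xi>')"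
  have D: "\<rho> (x k0 j) \<xi>' \<le> D" if "j \<in> {1..N k0}" for j
    unfolding D_def using that by (intro member_le_sum) auto
  have D0: "0 \<le> D" unfolding D_def by (intro sum_nonneg) auto
  have powr_sum: "(a + D) powr q' \<le> 2 powr q' * (1 + a powr q + D powr q')" if a: "0 \<le> a" for a
  proof -
    have "(a + D) powr q' \<le> (2 * max a D) powr q'"
      using exponents a D0 by (intro powr_mono2) auto
    also have "\<dots> = 2 powr q' * max a D powr q'" using a by (simp add: powr_mult)
    also have "max a D powr q' \<le> a powr q' + D powr q'" by (auto simp: max_def)
    \<comment> \<open>The smaller power is dominated by the larger one only for a \<ge> 1; the
      summand 1 covers the rest.\<close>
    also have "a powr q' \<le> 1 + a powr q"
    proof (cases "a \<le> 1")
      case True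
      then have "a powr q' \<le> 1" using exponents a by (intro powr_le1) auto
      then show ?thesis by (simp add: add_increasing2)
    next
      case False
      then have "a powr q' \<le> a powr q" using exponents by (intro powr_mono) auto
      then show ?thesis by simp
    qed
    finally show ?thesis by (simp add: algebra_simps)
  qed
  \<comment> \<open>\<open>L\<close> collects the coefficient of the cost, \<open>G\<close> all
    constants.\<close>
  define L where "L = g' * 2 powr q'"
  define G where "G = g' + L * (1 + D powr q')"
  have L: "0 \<le> L" and G: "0 \<le> G" using g by (auto simp: L_def G_def)
  have main: "l \<xi> \<le> L * cost k0 \<xi> \<alpha> + G" if *: "\<xi> \<in> \<Xi>" "\<alpha> \<in> multi_indices N" for \<xi> \<alpha>
  proof -
    define y where "y = x k0 (\<alpha> k0)"
    have y: "y \<in> \<Xi>" "\<rho> y \<xi>' \<le> D" using atoms D multi_indicesD[OF *(2)] by (auto simp: y_def)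
    have "\<rho> \<xi> \<xi>' \<le> \<rho> \<xi> y + D" using triangle[OF *(1) y(1) base_point] y(2) by simp
    then have "\<rho> \<xi> \<xi>' powr q' \<le> (\<rho> \<xi> y + D) powr q'" using exponents by (intro powr_mono2) auto
    also have "\<dots> \<le> 2 powr q' * (1 + \<rho> \<xi> y powr q + D powr q')" by (rule powr_sum) simp
    also have "\<dots> \<le> 2 powr q' * (1 + c \<xi> y + D powr q')"
      using c_ge[OF *(1) y(1)] by (intro mult_left_mono) auto
    finally have "g' * (1 + \<rho> \<xi> \<xi>' powr q') \<le> g' * (1 + 2 powr q' * (1 + c \<xi> y + D powr q'))"
      using g by (intro mult_left_mono) auto
    also have "\<dots> = L * cost k0 \<xi> \<alpha> + G" by (simp add: L_def G_def cost_def y_def algebra_simps)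
    finally show ?thesis using growth[OF *(1)] by linarith
  qed
  have "((\<chi> k. L), (\<lambda>k j. G)) \<in> dual_feasible \<Xi> c N x l"
    unfolding dual_feasible_iff
  proof (intro conjI allI ballI)
    show "0 \<le> (\<chi> k. L) $ k" for k using L by simp
    fix \<alpha> \<xi> assume *: "\<alpha> \<in> multi_indices N" "\<xi> \<in> \<Xi>"
    \<comment> \<open>The same multipliers serve every \<open>k\<close>: the summands other than
      \<open>k0\<close> are nonnegative and only help.\<close>
    have "L * cost k0 \<xi> \<alpha> + G \<le> (\<Sum>k\<in>UNIV. L * cost k \<xi> \<alpha> + G)"
      using L G * by (intro member_le_sum[where f = "\<lambda>k. L * cost k \<xi> \<alpha> + G"])
        (auto intro!: add_nonneg_nonneg mult_nonneg_nonneg cost_nonneg)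
    then show "l \<xi> \<le> (\<Sum>k\<in>UNIV. (\<chi> k. L) $ k * cost k \<xi> \<alpha> + G)" using main * by fastforce
  qed
  then show ?thesis by blast
qed

end

theorem theorem2:
  fixes \<Xi> :: "(real ^ 'd) set"
    and c \<rho> :: "real ^ 'd \<Rightarrow> real ^ 'd \<Rightarrow> real"
    and l :: "real ^ 'd \<Rightarrow> real"
    and P :: "'k::finite \<Rightarrow> (real ^ 'd) measure"
    and N :: "'k \<Rightarrow> nat"
    and p :: "'k \<Rightarrow> nat \<Rightarrow> real"
    and x :: "'k \<Rightarrow> nat \<Rightarrow> real ^ 'd"
    and q q' g' :: real and \<xi>' :: "real ^ 'd"
    and \<epsilon> :: "real ^ 'k"
  assumes Xi_closed: "closed \<Xi>" and Xi_convex: "convex \<Xi>"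
    and c_nonneg: "\<And>\<xi>\<^sub>1 \<xi>\<^sub>2. \<xi>\<^sub>1 \<in> \<Xi> \<Longrightarrow> \<xi>\<^sub>2 \<in> \<Xi> \<Longrightarrow> 0 \<le> c \<xi>\<^sub>1 \<xi>\<^sub>2"
    and l_usc: "usc_on \<Xi> l"
    and P_prob: "\<And>k. P k \<in> borel_prob \<Xi>"
    and c_lsc: "lsc_on (\<Xi> \<times> \<Xi>) (\<lambda>z. c (fst z) (snd z))"
    and c_zero: "\<And>\<xi>\<^sub>1 \<xi>\<^sub>2. \<xi>\<^sub>1 \<in> \<Xi> \<Longrightarrow> \<xi>\<^sub>2 \<in> \<Xi> \<Longrightarrow> c \<xi>\<^sub>1 \<xi>\<^sub>2 = 0 \<longleftrightarrow> \<xi>\<^sub>1 = \<xi>\<^sub>2"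
    and rho_metric: "Metric_space \<Xi> \<rho>"
    and rho_compact: "\<And>\<xi>\<^sub>0 r. \<xi>\<^sub>0 \<in> \<Xi> \<Longrightarrow> compact {\<xi> \<in> \<Xi>. \<rho> \<xi> \<xi>\<^sub>0 \<le> r}"
    and q_ge_1: "1 \<le> q"
    and c_ge_rho: "\<And>\<xi>\<^sub>1 \<xi>\<^sub>2. \<xi>\<^sub>1 \<in> \<Xi> \<Longrightarrow> \<xi>\<^sub>2 \<in> \<Xi> \<Longrightarrow> \<rho> \<xi>\<^sub>1 \<xi>\<^sub>2 powr q \<le> c \<xi>\<^sub>1 \<xi>\<^sub>2"
    and P_discrete: "\<And>k A. A \<in> sets (restrict_space borel \<Xi>) \<Longrightarrow>
      emeasure (P k) A =
        (\<Sum>j\<in>{1..N k}. ennreal (p k j) * emeasure (return (restrict_space borel \<Xi>) (x k j)) A)"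
    and atoms: "\<And>k j. j \<in> {1..N k} \<Longrightarrow> x k j \<in> \<Xi>"
    and weights_pos: "\<And>k j. j \<in> {1..N k} \<Longrightarrow> 0 < p k j"
    and base_point: "\<xi>' \<in> \<Xi>" and g_pos: "0 < g'" and exponents: "1 \<le> q'" "q' \<le> q"
    and l_growth: "\<And>\<xi>. \<xi> \<in> \<Xi> \<Longrightarrow> l \<xi> \<le> g' * (1 + \<rho> \<xi> \<xi>' powr q')"
    and eps_nonneg: "\<And>k. 0 \<le> \<epsilon> $ k"
  shows "primal_value \<Xi> c P l \<epsilon> \<le> dual_value \<Xi> c N p x l \<epsilon> \<and>
    (\<epsilon> \<notin> frontier (feasible_radii \<Xi> c P) \<longrightarrow>
       primal_value \<Xi> c P l \<epsilon> = dual_value \<Xi> c N p x l \<epsilon>)"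
proof -
  \<comment> \<open>Normalization of the weights follows by evaluating the probability measure
    \<open>P k\<close> on all of \<open>\<Xi>\<close>.\<close>
  have sum_weights: "(\<Sum>j\<in>{1..N k}. p k j) = 1" for k
  proof -
    interpret prob_space "P k" using P_prob[of k] by (simp add: borel_prob_def)
    have sets_P: "sets (P k) = sets (restrict_space borel \<Xi>)"
      using P_prob[of k] by (simp add: borel_prob_def)
    have space_P: "space (P k) = \<Xi>"
      using sets_eq_imp_space_eq[OF sets_P] by (simp add: space_restrict_space)
    have Xi: "\<Xi> \<in> sets (restrict_space borel \<Xi>)"
      using sets.top[of "P k"] by (simp add: sets_P space_P)
    have "1 = emeasure (P k) \<Xi>" using emeasure_space_1 by (simp add: space_P)
    also have "\<dots> = (\<Sum>j\<in>{1..N k}. ennreal (p k j))"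
      unfolding P_discrete[OF Xi] using Xi atoms[of _ k] by (intro sum.cong) auto
    also have "\<dots> = ennreal (\<Sum>j\<in>{1..N k}. p k j)"
      using weights_pos[of _ k] by (intro sum_ennreal) (auto intro: less_imp_le)
    finally show ?thesis by simp
  qed
  interpret discrete_transport_measures \<Xi> c N p x \<xi>' P
    by unfold_locales (fact c_nonneg atoms weights_pos sum_weights base_point c_lsc P_prob P_discrete)+
  have l: "l \<in> borel_measurable (restrict_space borel \<Xi>)"
    using l_usc by (rule borel_measurable_usc_on)
  have "dual_feasible \<Xi> c N x l \<noteq> {}"
    by (rule dual_feasible_nonempty[OF rho_metric c_ge_rho exponents g_pos l_growth])
  then show ?thesis
    using primal_le_dual[OF l eps_nonneg] strong_duality[OF l eps_nonneg] by blast
qed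

end
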